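(* Let $k$ be a field, let $P$ and $Q$ be two prime ideals of $S:=k[[X_1,\dots,X_d]]$, each generated by linear forms, and let $R:=S/PQ$. Then for every $\mathfrak p\in\operatorname{Assh}(R)$, every $u\in\mathfrak p$, and every ideal $I$ of $R$ generated by a system of parameters of $R$, one has $(0:_R u)\nsubseteq I$.
   Context: For a noetherian local ring $(R,\mathfrak m)$ of dimension $e$: a system of parameters is a sequence $x_1,\dots,x_e$ of elements of $\mathfrak m$ such that $R/(x_1,\dots,x_e)$ has finite length; $\operatorname{Assh}(R)=\{\mathfrak p\in\operatorname{Ass}(R):\dim R/\mathfrak p=\dim R\}$; $(0:_R u)=\{r\in R: ru=0\}$. *)

theory Defs
  imports "HOL-Algebra.Algebra" "HOL-Library.Multiset" "HOL-Library.Extended_Nat"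
begin

section \<open>Formal power series rings in finitely many variables\<close>

text \<open>As in \<^theory>\<open>HOL-Algebra.Indexed_Polynomials\<close>, a monomial is a multiset of
  variable indices: \<open>M\<close> stands for the product of the variables in \<open>M\<close>, with multiplicity.
  A power series is its coefficient function; the variables are indexed by \<open>{1..d}\<close>, and
  coefficients of multisets containing any other index are required to be zero.\<close>

definition power_series_ring ::
  "('a, 'm) ring_scheme \<Rightarrow> nat \<Rightarrow> (nat multiset \<Rightarrow> 'a) ring"
  where "power_series_ring K d =
    \<lparr> carrier = {f. (\<forall>M. f M \<in> carrier K) \<and>
                    (\<forall>M. \<not> set_mset M \<subseteq> {1..d} \<longrightarrow> f M = \<zero>\<^bsub>K\<^esub>)},
      monoid.mult = (\<lambda>f g M. \<Oplus>\<^bsub>K\<^esub>A\<in>{A. A \<subseteq># M}. f A \<otimes>\<^bsub>K\<^esub> g (M - A)),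
      one = (\<lambda>M. if M = {#} then \<one>\<^bsub>K\<^esub> else \<zero>\<^bsub>K\<^esub>),
      ring.zero = (\<lambda>M. \<zero>\<^bsub>K\<^esub>),
      ring.add = (\<lambda>f g M. f M \<oplus>\<^bsub>K\<^esub> g M) \<rparr>"

lemma power_series_ring_cring:
  assumes "cring K" shows "cring (power_series_ring K d)"
proof -
  interpret K: cring K by fact
  have fin: "finite {A. A \<subseteq># M}" for M :: "nat multiset"
  proof (rule finite_subset)
    show "{A. A \<subseteq># M} \<subseteq> mset ` {xs. set xs \<subseteq> set_mset M \<and> length xs \<le> size M}"
    proof
      fix A assume "A \<in> {A. A \<subseteq># M}"
      moreover obtain xs where "mset xs = A" using ex_mset by blast
      ultimately show "A \<in> mset ` {xs. set xs \<subseteq> set_mset M \<and> length xs \<le> size M}"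
        by (intro image_eqI[of _ _ xs]) (auto dest: mset_subset_eqD size_mset_mono)
    qed
    show "finite (mset ` {xs. set xs \<subseteq> set_mset M \<and> length xs \<le> size M})"
      by (intro finite_imageI finite_lists_length_le) simp
  qed
  note fin[simp]
  let ?S = "power_series_ring K d"
  have cl: "f \<in> carrier ?S \<Longrightarrow> f M \<in> carrier K" for f M by (simp add: power_series_ring_def)
  have cl0: "f \<in> carrier ?S \<Longrightarrow> \<not> set_mset M \<subseteq> {1..d} \<Longrightarrow> f M = \<zero>\<^bsub>K\<^esub>" for f M by (simp add: power_series_ring_def)
  have mulv: "(f \<otimes>\<^bsub>?S\<^esub> g) M = (\<Oplus>\<^bsub>K\<^esub>A\<in>{A. A \<subseteq># M}. f A \<otimes>\<^bsub>K\<^esub> g (M - A))" for f g M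
    by (simp add: power_series_ring_def)
  have addv: "(f \<oplus>\<^bsub>?S\<^esub> g) M = f M \<oplus>\<^bsub>K\<^esub> g M" for f g M by (simp add: power_series_ring_def)
  have mc: "f \<otimes>\<^bsub>?S\<^esub> g \<in> carrier ?S" if f: "f \<in> carrier ?S" and g: "g \<in> carrier ?S" for f g
  proof -
    have 1: "(f \<otimes>\<^bsub>?S\<^esub> g) M \<in> carrier K" for M
      unfolding mulv using cl[OF f] cl[OF g] by (intro K.finsum_closed) auto
    have 2: "(f \<otimes>\<^bsub>?S\<^esub> g) M = \<zero>\<^bsub>K\<^esub>" if n: "\<not> set_mset M \<subseteq> {1..d}" for M
    proof -
      have "f A \<otimes>\<^bsub>K\<^esub> g (M - A) = \<zero>\<^bsub>K\<^esub>" if A: "A \<subseteq># M" for A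
      proof (cases "set_mset A \<subseteq> {1..d}")
        case True
        have "set_mset M = set_mset A \<union> set_mset (M - A)"
          using A by (metis set_mset_union subset_mset.add_diff_inverse)
        with True n have "g (M - A) = \<zero>\<^bsub>K\<^esub>" by (intro cl0[OF g]) auto
        then show ?thesis using cl[OF f] by simp
      next
        case False then show ?thesis using cl0[OF f] cl[OF g] by simp
      qed
      then show ?thesis unfolding mulv by (intro K.add.finprod_one_eqI) auto
    qed
    from 1 2 show ?thesis by (auto simp: power_series_ring_def)
  qed
  have comm: "f \<otimes>\<^bsub>?S\<^esub> g = g \<otimes>\<^bsub>?S\<^esub> f" if f: "f \<in> carrier ?S" and g: "g \<in> carrier ?S" for f g
  proof
    fix M :: "nat multiset"
    have im: "{A. A \<subseteq># M} = (\<lambda>A. M - A) ` {A. A \<subseteq># M}"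
    proof safe
      fix A assume "A \<subseteq># M"
      then have "A = M - (M - A)" by (metis add_diff_cancel_right' subset_mset.add_diff_inverse)
      then show "A \<in> (\<lambda>A. M - A) ` {A. A \<subseteq># M}" by (intro image_eqI[of _ _ "M - A"]) auto
    qed auto
    have inj: "inj_on (\<lambda>A. M - A) {A. A \<subseteq># M}"
      by (rule inj_onI) (metis mem_Collect_eq add_diff_cancel_right' subset_mset.add_diff_inverse)
    have "(f \<otimes>\<^bsub>?S\<^esub> g) M = (\<Oplus>\<^bsub>K\<^esub>A\<in>(\<lambda>A. M - A) ` {A. A \<subseteq># M}. f A \<otimes>\<^bsub>K\<^esub> g (M - A))"
      unfolding mulv using im by simp
    also have "\<dots> = (\<Oplus>\<^bsub>K\<^esub>A\<in>{A. A \<subseteq># M}. f (M - A) \<otimes>\<^bsub>K\<^esub> g (M - (M - A)))"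
      by (rule K.finsum_reindex) (use cl[OF f] cl[OF g] inj in auto)
    also have "\<dots> = (\<Oplus>\<^bsub>K\<^esub>A\<in>{A. A \<subseteq># M}. g A \<otimes>\<^bsub>K\<^esub> f (M - A))"
    proof (rule K.finsum_cong', goal_cases)
      case (3 A)
      then have "M - (M - A) = A" by (metis mem_Collect_eq add_diff_cancel_right' subset_mset.add_diff_inverse)
      then show ?case using cl[OF f] cl[OF g] K.m_comm by simp
    qed (use cl[OF f] cl[OF g] in auto)
    finally show "(f \<otimes>\<^bsub>?S\<^esub> g) M = (g \<otimes>\<^bsub>?S\<^esub> f) M" unfolding mulv .
  qed
  have assoc: "f \<otimes>\<^bsub>?S\<^esub> g \<otimes>\<^bsub>?S\<^esub> h = f \<otimes>\<^bsub>?S\<^esub> (g \<otimes>\<^bsub>?S\<^esub> h)"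
    if f: "f \<in> carrier ?S" and g: "g \<in> carrier ?S" and h: "h \<in> carrier ?S" for f g h
  proof
    fix M :: "nat multiset"
    note c = cl[OF f] cl[OF g] cl[OF h]
    let ?T = "{(A,B). A + B \<subseteq># M} :: (nat multiset \<times> nat multiset) set"
    let ?F = "\<lambda>(A,B). f A \<otimes>\<^bsub>K\<^esub> g B \<otimes>\<^bsub>K\<^esub> h (M - (A + B))"
    have T1: "?T = (\<Union>C\<in>{C. C \<subseteq># M}. (\<lambda>A. (A, C - A)) ` {A. A \<subseteq># C})"
    proof safe
      fix A B assume "A + B \<subseteq># M"
      then show "(A, B) \<in> (\<Union>C\<in>{C. C \<subseteq># M}. (\<lambda>A. (A, C - A)) ` {A. A \<subseteq># C})"
        by (intro UN_I[of "A + B"] image_eqI[of _ _ A]) auto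
    qed auto
    have T2: "?T = (\<Union>A\<in>{A. A \<subseteq># M}. (\<lambda>B. (A, B)) ` {B. B \<subseteq># M - A})"
    proof -
      have "A + B \<subseteq># M \<longleftrightarrow> A \<subseteq># M \<and> B \<subseteq># M - A" for A B :: "nat multiset"
        by (metis add.commute mset_subset_eq_add_left subset_mset.le_diff_conv2 subset_mset.order_trans)
      then show ?thesis by auto
    qed
    have "(f \<otimes>\<^bsub>?S\<^esub> g \<otimes>\<^bsub>?S\<^esub> h) M = (\<Oplus>\<^bsub>K\<^esub>C\<in>{C. C \<subseteq># M}. (\<Oplus>\<^bsub>K\<^esub>A\<in>{A. A \<subseteq># C}. f A \<otimes>\<^bsub>K\<^esub> g (C - A) \<otimes>\<^bsub>K\<^esub> h (M - C)))"
      unfolding mulv using c by (intro K.finsum_cong') (auto simp: K.finsum_ldistr Pi_def)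
    also have "\<dots> = (\<Oplus>\<^bsub>K\<^esub>C\<in>{C. C \<subseteq># M}. finsum K ?F ((\<lambda>A. (A, C - A)) ` {A. A \<subseteq># C}))"
      using c by (intro K.finsum_cong') (auto simp: K.finsum_reindex inj_on_def Pi_def intro!: K.finsum_cong')
    also have "\<dots> = finsum K ?F ?T"
      unfolding T1 using c
      by (intro K.add.finprod_UN_disjoint[symmetric]) (auto simp: pairwise_def disjnt_def, metis subset_mset.diff_add)
    also have "\<dots> = (\<Oplus>\<^bsub>K\<^esub>A\<in>{A. A \<subseteq># M}. finsum K ?F ((\<lambda>B. (A, B)) ` {B. B \<subseteq># M - A}))"
      unfolding T2 using c
      by (intro K.add.finprod_UN_disjoint) (auto simp: pairwise_def disjnt_def)
    also have "\<dots> = (\<Oplus>\<^bsub>K\<^esub>A\<in>{A. A \<subseteq># M}. (\<Oplus>\<^bsub>K\<^esub>B\<in>{B. B \<subseteq># M - A}. f A \<otimes>\<^bsub>K\<^esub> (g B \<otimes>\<^bsub>K\<^esub> h (M - A - B))))"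
      using c by (intro K.finsum_cong') (auto simp: K.finsum_reindex inj_on_def Pi_def K.m_assoc intro!: K.finsum_cong')
    also have "\<dots> = (f \<otimes>\<^bsub>?S\<^esub> (g \<otimes>\<^bsub>?S\<^esub> h)) M"
      unfolding mulv using c by (intro K.finsum_cong') (auto simp: K.finsum_rdistr Pi_def)
    finally show "(f \<otimes>\<^bsub>?S\<^esub> g \<otimes>\<^bsub>?S\<^esub> h) M = (f \<otimes>\<^bsub>?S\<^esub> (g \<otimes>\<^bsub>?S\<^esub> h)) M" .
  qed
  have onec: "\<one>\<^bsub>?S\<^esub> \<in> carrier ?S" by (auto simp: power_series_ring_def)
  have onel: "\<one>\<^bsub>?S\<^esub> \<otimes>\<^bsub>?S\<^esub> f = f" if f: "f \<in> carrier ?S" for f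
  proof
    fix M :: "nat multiset"
    have "(\<one>\<^bsub>?S\<^esub> \<otimes>\<^bsub>?S\<^esub> f) M = (\<Oplus>\<^bsub>K\<^esub>A\<in>{A. A \<subseteq># M}. if {#} = A then f (M - A) else \<zero>\<^bsub>K\<^esub>)"
      unfolding mulv using cl[OF f] by (intro K.finsum_cong') (auto simp: power_series_ring_def)
    also have "\<dots> = f M"
      using K.finsum_singleton[of "{#}" "{A. A \<subseteq># M}" "\<lambda>A. f (M - A)"] cl[OF f] by simp
    finally show "(\<one>\<^bsub>?S\<^esub> \<otimes>\<^bsub>?S\<^esub> f) M = f M" .
  qed
  have dist: "(f \<oplus>\<^bsub>?S\<^esub> g) \<otimes>\<^bsub>?S\<^esub> h = f \<otimes>\<^bsub>?S\<^esub> h \<oplus>\<^bsub>?S\<^esub> g \<otimes>\<^bsub>?S\<^esub> h"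
    if f: "f \<in> carrier ?S" and g: "g \<in> carrier ?S" and h: "h \<in> carrier ?S" for f g h
  proof
    fix M :: "nat multiset"
    note c = cl[OF f] cl[OF g] cl[OF h]
    show "((f \<oplus>\<^bsub>?S\<^esub> g) \<otimes>\<^bsub>?S\<^esub> h) M = (f \<otimes>\<^bsub>?S\<^esub> h \<oplus>\<^bsub>?S\<^esub> g \<otimes>\<^bsub>?S\<^esub> h) M"
      unfolding addv mulv using c
      by (subst K.finsum_addf[symmetric]) (auto simp: K.l_distr intro!: K.finsum_cong')
  qed
  have ag: "abelian_group ?S"
  proof (rule abelian_groupI)
    fix f assume f: "f \<in> carrier ?S"
    then show "\<exists>y\<in>carrier ?S. y \<oplus>\<^bsub>?S\<^esub> f = \<zero>\<^bsub>?S\<^esub>"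
      by (intro bexI[of _ "\<lambda>M. \<ominus>\<^bsub>K\<^esub> f M"]) (auto simp: power_series_ring_def K.l_neg)
  qed (auto simp: power_series_ring_def K.a_ac fun_eq_iff)
  show ?thesis
    by (rule cringI[OF ag comm_monoidI dist]) (fact mc onec assoc onel comm | assumption)+
qed

definition linear_forms :: "('a, 'm) ring_scheme \<Rightarrow> nat \<Rightarrow> (nat multiset \<Rightarrow> 'a) set"
  where "linear_forms K d =
    {f \<in> carrier (power_series_ring K d). \<forall>M. f M \<noteq> \<zero>\<^bsub>K\<^esub> \<longrightarrow> size M = 1}"


section \<open>Dimension, length, associated primes, systems of parameters\<close>

text \<open>Chains of length \<open>n\<close> have \<open>n + 1\<close> members. The zero ring, which has no prime ideals,
  gets dimension 0 here.\<close>

definition krull_dim :: "('a, 'm) ring_scheme \<Rightarrow> enat"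
  where "krull_dim R = (SUP n \<in> {n. \<exists>p :: nat \<Rightarrow> 'a set.
    (\<forall>i\<le>n. primeideal (p i) R) \<and> (\<forall>i<n. p i \<subset> p (Suc i))}. enat n)"

definition module_length :: "('a, 'm) ring_scheme \<Rightarrow> ('a, 'b, 'n) module_scheme \<Rightarrow> enat"
  where "module_length R M = (SUP n \<in> {n. \<exists>N :: nat \<Rightarrow> 'b set.
    (\<forall>i\<le>n. submodule (N i) R M) \<and> (\<forall>i<n. N i \<subset> N (Suc i))}. enat n)"

text \<open>The fields \<open>mult\<close> and \<open>one\<close> are present only because the module record extends rings.\<close>

definition quot_module :: "('a, 'm) ring_scheme \<Rightarrow> 'a set \<Rightarrow> ('a, 'a set) module"
  where "quot_module R I =
    \<lparr> carrier = carrier (R Quot I), monoid.mult = monoid.mult (R Quot I), one = monoid.one (R Quot I),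
      ring.zero = ring.zero (R Quot I), ring.add = ring.add (R Quot I),
      smult = (\<lambda>r C. (I +>\<^bsub>R\<^esub> r) \<otimes>\<^bsub>R Quot I\<^esub> C) \<rparr>"

definition colon_zero :: "('a, 'm) ring_scheme \<Rightarrow> 'a \<Rightarrow> 'a set"
  where "colon_zero R u = {r \<in> carrier R. r \<otimes>\<^bsub>R\<^esub> u = \<zero>\<^bsub>R\<^esub>}"

definition Ass :: "('a, 'm) ring_scheme \<Rightarrow> 'a set set"
  where "Ass R = {p. primeideal p R \<and> (\<exists>r\<in>carrier R. p = colon_zero R r)}"

definition Assh :: "('a, 'm) ring_scheme \<Rightarrow> 'a set set"
  where "Assh R = {p \<in> Ass R. krull_dim (R Quot p) = krull_dim R}"

text \<open>The ideal \<open>\<mm>\<close> of a local ring; only meaningful if \<open>R\<close> is local.\<close>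

definition the_maximal_ideal :: "('a, 'm) ring_scheme \<Rightarrow> 'a set"
  where "the_maximal_ideal R = (THE M. maximalideal M R)"

definition system_of_parameters :: "('a, 'm) ring_scheme \<Rightarrow> 'a list \<Rightarrow> bool"
  where "system_of_parameters R xs \<longleftrightarrow>
    enat (length xs) = krull_dim R \<and>
    set xs \<subseteq> the_maximal_ideal R \<and>
    module_length R (quot_module R (Idl\<^bsub>R\<^esub> (set xs))) \<noteq> \<infinity>"

end

theory Submission
  imports Defs "HOL-Library.Multiset_Order"
begin

text \<open>Let \<open>\<mm>\<close> be the maximal ideal of \<open>S\<close>. A prime \<open>p\<close> in \<open>Assh R\<close> pulls back to a prime of \<open>S\<close>
  containing \<open>P\<close> or \<open>Q\<close>, say \<open>P\<close>; by maximality of the dimension of \<open>R/p\<close> it pulls back to \<open>P\<close>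
  itself. If \<open>P = 0\<close>, then \<open>u = 0\<close> and its annihilator is \<open>R\<close>. Otherwise \<open>Q\<close> annihilates \<open>u\<close>, so if
  the claim fails, \<open>Q\<close> is contained in \<open>F + PQ\<close>, where \<open>F\<close> is generated by lifts of the \<open>e\<close>
  parameters. Iterating gives \<open>Q \<subseteq> F + \<mm>\<^sup>n\<close> for all \<open>n\<close>, and finite length then yields an \<open>s\<close>
  with \<open>\<mm>\<^sup>s \<subseteq> F + \<mm>\<^sup>n\<close> for all \<open>n\<close>. But \<open>e = dim S/P\<close>, so \<open>S\<close> has a chain of \<open>e + 1\<close> strict
  inclusions of primes \<open>p\<^sub>0 \<subset> \<dots> \<subset> p\<^sub>r\<close>, \<open>r = e + 1\<close>, starting at \<open>0\<close>. This is impossible by counting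
  dimensions over \<open>K\<close>: choosing \<open>x\<^sub>i\<close> in \<open>p\<^sub>i\<^sub>+\<^sub>1\<close> but not in \<open>p\<^sub>i\<close>, the
  \<open>N\<^sup>r\<close> monomials in the \<open>x\<^sub>i\<close> with all exponents below \<open>N\<close> are linearly independent modulo \<open>\<mm>\<^sup>n\<close> for
  some \<open>n = 1 + CN\<close> (Artin--Rees), whereas \<open>S/\<mm>\<^sup>n\<close> is spanned by at most \<open>c n\<^sup>e\<close> elements.\<close>

section \<open>Linear algebra modulo an ideal\<close>

text \<open>Congruence modulo \<open>U\<close> stands in for the quotient by \<open>U\<close>:
  scalars, vectors and combinations all stay in \<open>R\<close>. Since \<open>combine\<close> takes
  its coefficients from \<open>R\<close> itself, a subfield \<open>k\<close> of the ring serves as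
  ground field.\<close>

definition (in ring) span_mod :: "'a set \<Rightarrow> 'a set \<Rightarrow> 'a list \<Rightarrow> 'a set"
  where "span_mod k U us =
    {z \<in> carrier R. \<exists>Ks. length Ks = length us \<and> set Ks \<subseteq> k \<and> z \<ominus> combine Ks us \<in> U}"

text \<open>Independence is a property of the list and not of its set of entries, so that
  \<open>length\<close> can be compared directly with a number of generators.\<close>

definition (in ring) indep_mod :: "'a set \<Rightarrow> 'a set \<Rightarrow> 'a list \<Rightarrow> bool"
  where "indep_mod k U us \<longleftrightarrow>
    (\<forall>Ks. length Ks = length us \<and> set Ks \<subseteq> k \<and> combine Ks us \<in> U \<longrightarrow> set Ks \<subseteq> {\<zero>})"

text \<open>The products of \<open>x [^] i\<close> and \<open>u\<close> with \<open>i < N\<close>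
  and \<open>u\<close> in \<open>us\<close>. The same list serves both estimates: it is independent
  when \<open>x\<close> steps up a chain of primes, and it spans when \<open>x\<close> is one of the
  lifted parameters.\<close>

fun (in ring) power_multiples :: "'a \<Rightarrow> 'a list \<Rightarrow> nat \<Rightarrow> 'a list"
  where
    "power_multiples x us 0 = []"
  | "power_multiples x us (Suc N) = us @ map (\<lambda>u. x \<otimes> u) (power_multiples x us N)"

lemma (in ring) length_power_multiples [simp]: "length (power_multiples x us N) = N * length us"
  by (induction N) auto

lemma (in ring) power_multiples_closed:
  assumes "x \<in> carrier R" "set us \<subseteq> carrier R"
  shows "set (power_multiples x us N) \<subseteq> carrier R"
  using assms by (induction N) auto

lemma (in cring) combine_map_mult:
  assumes "x \<in> carrier R" "set us \<subseteq> carrier R" "set Ks \<subseteq> carrier R" "length Ks = length us"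
  shows "combine Ks (map (\<lambda>u. x \<otimes> u) us) = x \<otimes> combine Ks us"
  using assms(4,2,3)
  by (induction Ks us rule: list_induct2) (use assms(1) in \<open>auto simp: r_distr m_lcomm\<close>)

lemma (in ring) combine_append_eq:
  assumes "length Ks = length us" "set us \<subseteq> carrier R" "set Ks \<subseteq> carrier R"
    "set vs \<subseteq> carrier R" "set Ls \<subseteq> carrier R"
  shows "combine (Ks @ Ls) (us @ vs) = combine Ks us \<oplus> combine Ls vs"
  using assms by (intro combine_append[symmetric]) auto

lemma (in ring) combine_zeros:
  assumes "set us \<subseteq> carrier R" shows "combine (replicate n \<zero>) us = \<zero>"
  using assms
proof (induction us arbitrary: n)
  case (Cons u us)
  then show ?case by (cases n) auto
qed (cases n, auto)

lemma (in ideal) combine_mem: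
  assumes "set Ks \<subseteq> carrier R" "set us \<subseteq> I"
  shows "combine Ks us \<in> I"
  using assms by (induction Ks us rule: combine.induct) (auto intro: I_l_closed)

lemma (in ideal) minus_mem: "a \<in> I \<Longrightarrow> b \<in> I \<Longrightarrow> a \<ominus> b \<in> I"
  by (simp add: a_minus_def)

lemma (in ideal) minus_add_mem:
  "a \<ominus> b \<in> I \<Longrightarrow> b \<in> I \<Longrightarrow> a \<in> carrier R \<Longrightarrow> a \<in> I"
proof -
  assume h: "a \<ominus> b \<in> I" "b \<in> I" "a \<in> carrier R"
  then have "(a \<ominus> b) \<oplus> b \<in> I" by auto
  moreover have "(a \<ominus> b) \<oplus> b = a"
    using h Icarr by (simp add: a_minus_def a_assoc l_neg)
  ultimately show "a \<in> I" by simp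
qed

text \<open>For the exchange step: a relation among the corrected vectors
  \<open>u \<ominus> m \<otimes> u0\<close> turns into one among the original vectors, in which
  \<open>u0\<close> collects a single coefficient.\<close>

lemma (in cring) combine_sub_multiples:
  assumes "length Ks = length ms" "length Ks = length us" "u0 \<in> carrier R"
    "set Ks \<subseteq> carrier R" "set ms \<subseteq> carrier R" "set us \<subseteq> carrier R"
  shows "combine Ks (map2 (\<lambda>m u. u \<ominus> m \<otimes> u0) ms us) = combine Ks us \<ominus> combine Ks ms \<otimes> u0"
proof -
  have "length ms = length us" using assms by simp
  from assms(1) this assms(4-6) show ?thesis
  proof (induction Ks ms us rule: list_induct3)
  case (Cons k Ks m ms u us)
  have c: "combine Ks us \<in> carrier R" "combine Ks ms \<in> carrier R" 
    using Cons.prems by auto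
  have kmu: "k \<in> carrier R" "m \<in> carrier R" "u \<in> carrier R" using Cons.prems by auto
  have "k \<otimes> (u \<ominus> m \<otimes> u0) \<oplus> (combine Ks us \<ominus> combine Ks ms \<otimes> u0)
     = (k \<otimes> u \<oplus> combine Ks us) \<ominus> (k \<otimes> m \<oplus> combine Ks ms) \<otimes> u0"
    using kmu c assms(3) by (simp add: a_minus_def r_distr l_distr minus_add r_minus a_ac m_assoc)
  then show ?case using Cons assms(3) by simp
qed (use assms(3) in \<open>auto simp: a_minus_def\<close>)
qed

text \<open>Steinitz exchange, modulo \<open>U\<close>.\<close>

lemma (in cring) dependent_mod:
  assumes k: "subfield k R" and U: "ideal U R"
    and "set gs \<subseteq> carrier R" "set us \<subseteq> span_mod k U gs" "length gs < length us"
  shows "\<not> indep_mod k U us"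
  using assms(3-)
proof (induction gs arbitrary: us)
  case Nil
  interpret U: ideal U R by fact
  have kc: "k \<subseteq> carrier R" "\<zero> \<in> k" "\<one> \<in> k" 
    using k subfieldE(3) subringE(2,3) subfieldE(1) by metis+
  have ne: "\<one> \<noteq> \<zero>" using k by (meson subfieldE(6))
  obtain u us' where us: "us = u # us'" using Nil by (cases us) auto
  have uU: "set us \<subseteq> U" using Nil(2) by (auto simp: span_mod_def a_minus_def)
  then have usc: "set us \<subseteq> carrier R" using U.Icarr by auto
  show ?case unfolding indep_mod_def
  proof (intro notI)
    assume h: "\<forall>Ks. length Ks = length us \<and> set Ks \<subseteq> k \<and> combine Ks us \<in> U \<longrightarrow> set Ks \<subseteq> {\<zero>}"
    \<comment> \<open>Without generators all of \<open>us\<close> lies in \<open>U\<close>, so any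
      coefficients give a relation; the leading \<open>\<one>\<close> makes this one
      nontrivial.\<close>
    let ?K = "\<one> # replicate (length us') \<zero>"
    have "set ?K \<subseteq> k" using kc by auto
    moreover have "combine ?K us \<in> U"
      by (rule U.combine_mem) (use uU in auto)
    ultimately show False using h[rule_format, of ?K] us ne by auto
  qed
next
  case (Cons g gs)
  interpret U: ideal U R by fact
  note kE = subringE(2,3,5,6,7)[OF subfieldE(1)[OF k]] subfieldE(3)[OF k]
  have gc: "g \<in> carrier R" "set gs \<subseteq> carrier R" using Cons.prems by auto
  show ?case
  proof (cases "set us \<subseteq> span_mod k U gs")
    case True
    then show ?thesis using Cons by auto
  next
    case False
    \<comment> \<open>\<open>u0\<close> cannot be expressed without \<open>g\<close>, so its
      coefficient \<open>l0\<close> at \<open>g\<close> is nonzero and can be inverted.\<close>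
    then obtain u0 where u0: "u0 \<in> set us" "u0 \<notin> span_mod k U gs" by auto
    have ex: "\<exists>l Ks. l \<in> k \<and> length Ks = length gs \<and> set Ks \<subseteq> k \<and> u \<ominus> (l \<otimes> g \<oplus> combine Ks gs) \<in> U"
      if "u \<in> set us" for u
    proof -
      have "u \<in> span_mod k U (g # gs)" using Cons.prems that by auto
      then obtain Ks where Ks: "length Ks = Suc (length gs)" "set Ks \<subseteq> k" "u \<ominus> combine Ks (g # gs) \<in> U"
        unfolding span_mod_def by auto
      then obtain l Ls where "Ks = l # Ls" by (cases Ks) auto
      with Ks show ?thesis by (intro exI[of _ l] exI[of _ Ls]) auto
    qed
    have usc: "set us \<subseteq> carrier R" using Cons.prems by (auto simp: span_mod_def)
    obtain l0 K0 where l0: "l0 \<in> k" "length K0 = length gs" "set K0 \<subseteq> k"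
      "u0 \<ominus> (l0 \<otimes> g \<oplus> combine K0 gs) \<in> U" using ex[OF u0(1)] by auto
    have u0c: "u0 \<in> carrier R" using u0 usc by auto
    have l0n: "l0 \<noteq> \<zero>"
    proof
      assume "l0 = \<zero>"
      then have "u0 \<ominus> combine K0 gs \<in> U" using l0 gc kE by (simp add: subset_eq)
      then show False using u0 l0 u0c by (auto simp: span_mod_def)
    qed
    have inv: "inv l0 \<in> k" "l0 \<otimes> inv l0 = \<one>"
      using subfield_m_inv[OF k] l0 l0n by auto
    have ex2: "\<exists>m\<in>k. u \<ominus> m \<otimes> u0 \<in> span_mod k U gs" if u: "u \<in> set us" for u
    proof -
      obtain l Ks where l: "l \<in> k" "length Ks = length gs" "set Ks \<subseteq> k"
        "u \<ominus> (l \<otimes> g \<oplus> combine Ks gs) \<in> U" using ex[OF u] by auto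
      \<comment> \<open>The multiple of \<open>u0\<close> that cancels the \<open>g\<close>-part of
        \<open>u\<close>.\<close>
      define m where "m = l \<otimes> inv l0"
      have mk: "m \<in> k" using l inv kE by (auto simp: m_def)
      define Ls where "Ls = map2 (\<oplus>) Ks (map (\<lambda>c. (\<ominus> m) \<otimes> c) K0)"
      have kc: "x \<in> k \<Longrightarrow> x \<in> carrier R" for x using kE by auto
      have Lsk: "set Ls \<subseteq> k" "length Ls = length gs"
        using l l0 mk kE(3-5) 
        by (auto simp: Ls_def subset_eq set_zip)
      have cL: "combine Ls gs = combine Ks gs \<oplus> (\<ominus> m) \<otimes> combine K0 gs"
      proof -
        have "combine Ls gs = combine Ks gs \<oplus> combine (map (\<lambda>c. (\<ominus> m) \<otimes> c) K0) gs"
          unfolding Ls_def by (rule combine_add[symmetric]) (use l l0 gc kc mk in \<open>auto simp: subset_eq\<close>)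
        also have "combine (map (\<lambda>c. (\<ominus> m) \<otimes> c) K0) gs = (\<ominus> m) \<otimes> combine K0 gs"
          by (rule combine_r_distr[symmetric]) (use l l0 gc kc mk in \<open>auto simp: subset_eq\<close>)
        finally show ?thesis .
      qed
      have cc: "combine Ks gs \<in> carrier R" "combine K0 gs \<in> carrier R" "u \<in> carrier R" "m \<in> carrier R" "l \<in> carrier R"
          "l0 \<in> carrier R" "inv l0 \<in> carrier R"
        using l l0 gc kc mk usc u inv by (auto simp: subset_eq)
      have ml: "m \<otimes> l0 = l" using inv(2) cc by (simp add: m_def m_assoc m_comm[of "inv l0"])
      have "(u \<ominus> m \<otimes> u0) \<ominus> combine Ls gs = (u \<ominus> (l \<otimes> g \<oplus> combine Ks gs)) \<ominus> m \<otimes> (u0 \<ominus> (l0 \<otimes> g \<oplus> combine K0 gs))"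
        unfolding cL ml[symmetric] using cc u0c gc by algebra
      also have "\<dots> \<in> U" by (rule U.minus_mem[OF l(4) U.I_l_closed[OF l0(4) cc(4)]])
      finally show ?thesis using mk Lsk cc u0c
        by (intro bexI[of _ m]) (auto simp: span_mod_def intro!: exI[of _ Ls])
    qed
    then obtain mu where mu: "\<And>u. u \<in> set us \<Longrightarrow> mu u \<in> k \<and> u \<ominus> mu u \<otimes> u0 \<in> span_mod k U gs"
      by metis
    \<comment> \<open>\<open>u0\<close> is exchanged for \<open>g\<close>: the other vectors,
      corrected by multiples of \<open>u0\<close>, are spanned by \<open>gs\<close> alone, and the
      induction hypothesis gives a relation among them.\<close>
    obtain as bs where us: "us = as @ u0 # bs" using u0(1) by (meson split_list)
    define vs where "vs = map2 (\<lambda>m u. u \<ominus> m \<otimes> u0) (map mu (as @ bs)) (as @ bs)"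
    have "map2 f (map mu xs) xs = map (\<lambda>u. f (mu u) u) xs" for f :: "'a \<Rightarrow> 'a \<Rightarrow> 'a" and xs
      by (induction xs) auto
    then have vs': "vs = map (\<lambda>u. u \<ominus> mu u \<otimes> u0) (as @ bs)"
      unfolding vs_def by blast
    have "set vs \<subseteq> span_mod k U gs" unfolding vs' using mu us by auto
    moreover have "length gs < length vs" using Cons.prems us by (simp add: vs')
    ultimately have "\<not> indep_mod k U vs" using Cons.IH gc by blast
    then obtain Ks where Ks: "length Ks = length (as @ bs)" "set Ks \<subseteq> k" "combine Ks vs \<in> U" "\<not> set Ks \<subseteq> {\<zero>}"
      unfolding indep_mod_def by (auto simp: vs')
    have muk: "set (map mu (as @ bs)) \<subseteq> k" using mu us by auto
    define K1 K2 where "K1 = take (length as) Ks" and "K2 = drop (length as) Ks"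
    have K12: "Ks = K1 @ K2" "length K1 = length as" "length K2 = length bs"
      using Ks(1) by (simp_all add: K1_def K2_def)
    have Kc: "set Ks \<subseteq> carrier R" using Ks(2) kE(6) by blast
    have muc: "set (map mu (as @ bs)) \<subseteq> carrier R" using muk kE(6) by blast
    have abc: "set (as @ bs) \<subseteq> carrier R" using usc us by auto
    define c where "c = combine Ks (map mu (as @ bs))"
    have ck: "c \<in> k"
    proof -
      have "combine Ls ms \<in> k" if "set Ls \<subseteq> k" "set ms \<subseteq> k" for Ls ms
        using that kE by (induction Ls ms rule: combine.induct) auto
      then show ?thesis unfolding c_def using Ks(2) muk by blast
    qed
    have cvs: "combine Ks vs = combine Ks (as @ bs) \<ominus> c \<otimes> u0"
      unfolding vs_def c_def
      by (rule combine_sub_multiples) (use Ks(1) Kc muc abc u0c in auto)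
    \<comment> \<open>The relation reread in \<open>us\<close>: \<open>u0\<close> receives the
      coefficient \<open>\<ominus> c\<close> at its original place, while the other coefficients,
      not all zero, are kept.\<close>
    have e1: "combine (K1 @ (\<ominus> c) # K2) us = combine K1 as \<oplus> ((\<ominus> c) \<otimes> u0 \<oplus> combine K2 bs)"
      unfolding us using K12 Kc abc u0c ck kE(6) by (subst combine_append_eq) auto
    have e2: "combine Ks (as @ bs) = combine K1 as \<oplus> combine K2 bs"
      using K12 Kc abc by (simp add: combine_append_eq)
    have "combine (K1 @ (\<ominus> c) # K2) us = combine Ks vs"
    proof -
      have "combine K1 as \<in> carrier R" "combine K2 bs \<in> carrier R" "c \<in> carrier R"
        using K12 Kc abc ck kE(6) by auto
      then show ?thesis unfolding cvs e1 e2 using u0c by algebra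
    qed
    moreover have "set (K1 @ (\<ominus> c) # K2) \<subseteq> k" using Ks(2) K12 ck kE by auto
    moreover have "length (K1 @ (\<ominus> c) # K2) = length us" using K12 us by simp
    moreover have "\<not> set (K1 @ (\<ominus> c) # K2) \<subseteq> {\<zero>}" using Ks(4) K12 by auto
    ultimately show ?thesis unfolding indep_mod_def using Ks(3) by metis
  qed
qed

text \<open>In a relation, the block with exponent 0 lies in \<open>V\<close> by
  \<open>step\<close>, so its coefficients vanish. Then \<open>canc\<close> divides the rest by
  \<open>x\<close>, which leaves a relation with one block less modulo the preceding
  \<open>W\<close>. In the application \<open>V\<close> and \<open>W n\<close> belong to successive
  primes of a chain, and \<open>x\<close> lies in the larger prime only.\<close>

lemma (in cring) indep_mod_power_multiples:
  assumes k: "subfield k R" and us: "set us \<subseteq> carrier R" and x: "x \<in> carrier R"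
    and ind: "indep_mod k V us"
    and step: "\<And>n y z. n < N \<Longrightarrow> y \<in> carrier R \<Longrightarrow> z \<in> carrier R \<Longrightarrow> y \<oplus> x \<otimes> z \<in> W (Suc n) \<Longrightarrow> y \<in> V"
    and canc: "\<And>n z. n < N \<Longrightarrow> z \<in> carrier R \<Longrightarrow> x \<otimes> z \<in> W (Suc n) \<Longrightarrow> z \<in> W n"
  shows "indep_mod k (W N) (power_multiples x us N)"
  using step canc
proof (induction N)
  case 0
  then show ?case by (auto simp: indep_mod_def)
next
  case (Suc N)
  have kc: "k \<subseteq> carrier R" using k subfieldE(3) by blast
  let ?F = "power_multiples x us N"
  have Fc: "set ?F \<subseteq> carrier R" using us x power_multiples_closed by blast
  have IH: "indep_mod k (W N) ?F" using Suc.prems by (intro Suc.IH) (metis less_Suc_eq)+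
  show ?case unfolding indep_mod_def
  proof (intro allI impI, elim conjE)
    fix Ks assume Ks: "length Ks = length (power_multiples x us (Suc N))" "set Ks \<subseteq> k"
      "combine Ks (power_multiples x us (Suc N)) \<in> W (Suc N)"
    define K1 K2 where "K1 = take (length us) Ks" and "K2 = drop (length us) Ks"
    have K12: "Ks = K1 @ K2" "length K1 = length us" "length K2 = length ?F"
      using Ks(1) by (simp_all add: K1_def K2_def)
    have Kc: "set Ks \<subseteq> carrier R" using Ks kc by blast
    have cc: "combine K1 us \<in> carrier R" "combine K2 ?F \<in> carrier R" using K12 Kc us Fc by auto
    have "combine Ks (power_multiples x us (Suc N)) = combine K1 us \<oplus> combine K2 (map (\<lambda>u. x \<otimes> u) ?F)"
      unfolding K12(1) power_multiples.simps using K12 Kc us Fc x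
      by (intro combine_append_eq) auto
    also have "combine K2 (map (\<lambda>u. x \<otimes> u) ?F) = x \<otimes> combine K2 ?F"
      using K12 Kc Fc x by (intro combine_map_mult) auto
    finally have eq: "combine K1 us \<oplus> x \<otimes> combine K2 ?F \<in> W (Suc N)" using Ks(3) by simp
    then have "combine K1 us \<in> V" using Suc.prems(1)[of N] cc by blast
    then have z1: "set K1 \<subseteq> {\<zero>}" using ind K12 Ks(2) unfolding indep_mod_def by auto
    then have "K1 = replicate (length K1) \<zero>" by (simp add: replicate_length_same subset_eq)
    then have "combine K1 us = \<zero>" using combine_zeros[OF us] by metis
    then have "x \<otimes> combine K2 ?F \<in> W (Suc N)" using eq cc x by simp
    then have "combine K2 ?F \<in> W N" using Suc.prems(2)[of N] cc by blast
    then have "set K2 \<subseteq> {\<zero>}" using IH K12 Ks(2) unfolding indep_mod_def by auto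
    then show "set Ks \<subseteq> {\<zero>}" using z1 K12(1) by auto
  qed
qed

text \<open>The term \<open>x \<otimes> y\<close> is inserted and taken away again; this is one
  round of the successive approximation below.\<close>

lemma (in cring) telescope_identity:
  assumes "z \<in> carrier R" "x \<in> carrier R" "y \<in> carrier R" "w \<in> carrier R"
    "a \<in> carrier R" "b \<in> carrier R" "p \<in> carrier R"
  shows "z \<ominus> (a \<oplus> x \<otimes> b) \<ominus> (p \<otimes> x) \<otimes> w
    = (z \<ominus> a \<ominus> x \<otimes> y) \<oplus> x \<otimes> (y \<ominus> b \<ominus> p \<otimes> w)"
proof -
  have "(z \<ominus> a \<ominus> A) \<oplus> (A \<ominus> B \<ominus> C) = z \<ominus> (a \<oplus> B) \<ominus> C"
    if "A \<in> carrier R" "B \<in> carrier R" "C \<in> carrier R" for A B C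
    using that assms by (simp add: a_minus_def minus_add a_assoc r_neg1 r_neg2)
  from this[of "x \<otimes> y" "x \<otimes> b" "p \<otimes> x \<otimes> w"] show ?thesis
    using assms by (simp add: a_minus_def r_distr r_minus m_ac)
qed

text \<open>Successive approximation: the factor \<open>y\<close> left over from \<open>z\<close> is
  expanded in the same way, and after \<open>n\<close> rounds the remainder is a multiple of
  \<open>x [^] n\<close>, which lies in \<open>U\<close>.\<close>

lemma (in cring) span_mod_power_multiples:
  assumes k: "k \<subseteq> carrier R" and U: "ideal U R" and x: "x \<in> carrier R" and xn: "x [^] (n::nat) \<in> U"
    and us: "set us \<subseteq> carrier R"
    and sp: "\<And>z. z \<in> carrier R \<Longrightarrow> \<exists>Ks y. length Ks = length us \<and> set Ks \<subseteq> k \<and> y \<in> carrier R \<and>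
        z \<ominus> combine Ks us \<ominus> x \<otimes> y \<in> U"
  shows "span_mod k U (power_multiples x us n) = carrier R"
proof -
  interpret U: ideal U R by fact
  have *: "\<exists>Ks y. length Ks = N * length us \<and> set Ks \<subseteq> k \<and> y \<in> carrier R \<and>
        z \<ominus> combine Ks (power_multiples x us N) \<ominus> x [^] N \<otimes> y \<in> U" if "z \<in> carrier R" for z N
    using that
  proof (induction N arbitrary: z)
    case 0
    then show ?case by (intro exI[of _ "[]"] exI[of _ z]) (auto simp: a_minus_def r_neg)
  next
    case (Suc N)
    let ?F = "power_multiples x us N"
    have Fc: "set ?F \<subseteq> carrier R" using us x power_multiples_closed by blast
    obtain K1 y where 1: "length K1 = length us" "set K1 \<subseteq> k" "y \<in> carrier R"
        "z \<ominus> combine K1 us \<ominus> x \<otimes> y \<in> U" using sp[OF Suc.prems] by blast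
    obtain K2 w where 2: "length K2 = N * length us" "set K2 \<subseteq> k" "w \<in> carrier R"
        "y \<ominus> combine K2 ?F \<ominus> x [^] N \<otimes> w \<in> U" using Suc.IH[OF 1(3)] by blast
    have Kc: "set K1 \<subseteq> carrier R" "set K2 \<subseteq> carrier R" using 1 2 k by auto
    have cc: "combine K1 us \<in> carrier R" "combine K2 ?F \<in> carrier R" "x [^] N \<in> carrier R" using Kc us Fc x by auto
    have "combine (K1 @ K2) (power_multiples x us (Suc N)) = combine K1 us \<oplus> combine K2 (map (\<lambda>u. x \<otimes> u) ?F)"
      unfolding power_multiples.simps using 1 2 Kc us Fc x
      by (intro combine_append_eq) auto
    also have "combine K2 (map (\<lambda>u. x \<otimes> u) ?F) = x \<otimes> combine K2 ?F"
      using 2 Kc Fc x by (intro combine_map_mult) auto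
    finally have cs: "combine (K1 @ K2) (power_multiples x us (Suc N)) = combine K1 us \<oplus> x \<otimes> combine K2 ?F" .
    have "z \<ominus> combine (K1 @ K2) (power_multiples x us (Suc N)) \<ominus> x [^] (Suc N) \<otimes> w
       = (z \<ominus> combine K1 us \<ominus> x \<otimes> y) \<oplus> x \<otimes> (y \<ominus> combine K2 ?F \<ominus> x [^] N \<otimes> w)"
      unfolding cs nat_pow_Suc using cc x Suc.prems 1(3) 2(3) by (intro telescope_identity) auto
    also have "\<dots> \<in> U" using 1 2 x by (intro U.a_closed U.I_l_closed) auto
    finally show ?case using 1 2 by (intro exI[of _ "K1 @ K2"] exI[of _ w]) auto
  qed
  have "z \<in> span_mod k U (power_multiples x us n)" if z: "z \<in> carrier R" for z
  proof -
    obtain Ks y where K: "length Ks = n * length us" "set Ks \<subseteq> k" "y \<in> carrier R"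
        "z \<ominus> combine Ks (power_multiples x us n) \<ominus> x [^] n \<otimes> y \<in> U" using *[OF z] by blast
    have "combine Ks (power_multiples x us n) \<in> carrier R"
      using K k power_multiples_closed[OF x us] by auto
    then have "z \<ominus> combine Ks (power_multiples x us n) \<in> U"
      using U.minus_add_mem[OF K(4)] U.I_r_closed[OF xn K(3)] z by simp
    then show ?thesis using K z by (auto simp: span_mod_def)
  qed
  then show ?thesis by (auto simp: span_mod_def)
qed

section \<open>A degree-compatible monomial order\<close>

text \<open>Comparing sizes first makes the leading monomial of a power series one of least degree, so
  that the division theorem below controls degrees.\<close>

definition mless :: "nat multiset \<Rightarrow> nat multiset \<Rightarrow> bool"
  where "mless M N \<longleftrightarrow> size M < size N \<or> size M = size N \<and> M < N"

text \<open>Well-foundedness yields both the existence of leading monomials and the recursion in the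
  division theorem.\<close>

lemma wf_mless: "wf {(M, N). mless M N}"
proof (rule wf_subset)
  show "wf (inv_image (less_than <*lex*> {(M :: nat multiset, N). M < N}) (\<lambda>M. (size M, M)))"
    by (intro wf_inv_image wf_lex_prod wf_less_than wf)
qed (auto simp: mless_def)

lemma mless_linear: "mless M N \<or> M = N \<or> mless N M"
  by (auto simp: mless_def)

lemma mless_irrefl [simp]: "\<not> mless M M"
  by (auto simp: mless_def)

lemma mless_size: "mless M N \<Longrightarrow> size M \<le> size N"
  by (auto simp: mless_def)

lemma mless_add_left: "mless (A + M) (A + N) \<longleftrightarrow> mless M N"
  by (auto simp: mless_def)

lemma mless_add_right: "mless (M + A) (N + A) \<longleftrightarrow> mless M N"
  by (auto simp: mless_def)

lemma mless_trans: "mless L M \<Longrightarrow> mless M N \<Longrightarrow> mless L N"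
  by (auto simp: mless_def)

lemma finite_submultisets: "finite {A. A \<subseteq># (M :: 'b multiset)}"
proof (rule finite_subset)
  show "{A. A \<subseteq># M} \<subseteq> mset ` {xs. set xs \<subseteq> set_mset M \<and> length xs \<le> size M}"
  proof
    fix A assume "A \<in> {A. A \<subseteq># M}"
    moreover obtain xs where "mset xs = A" using ex_mset by blast
    ultimately show "A \<in> mset ` {xs. set xs \<subseteq> set_mset M \<and> length xs \<le> size M}"
      by (intro image_eqI[of _ _ xs]) (auto dest: mset_subset_eqD size_mset_mono)
  qed
  show "finite (mset ` {xs. set xs \<subseteq> set_mset M \<and> length xs \<le> size M})"
    by (intro finite_imageI finite_lists_length_le) simp
qed

lemma finite_bounded_multisets:
  assumes "finite V" shows "finite {M. set_mset M \<subseteq> V \<and> size M < n}"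
proof (rule finite_subset)
  show "{M. set_mset M \<subseteq> V \<and> size M < n} \<subseteq> mset ` {xs. set xs \<subseteq> V \<and> length xs \<le> n}"
  proof
    fix M assume "M \<in> {M. set_mset M \<subseteq> V \<and> size M < n}"
    moreover obtain xs where "mset xs = M" using ex_mset by blast
    ultimately show "M \<in> mset ` {xs. set xs \<subseteq> V \<and> length xs \<le> n}"
      by (intro image_eqI[of _ _ xs]) auto
  qed
qed (use assms finite_lists_length_le in blast)

section \<open>Dickson's lemma\<close>

text \<open>A monotone subsequence always exists. If it is decreasing, it is constant from the index
  \<open>n0\<close> on at which its minimum is attained, and its tail from there is the subsequence
  sought.\<close>

lemma nat_seq_mono_subseq:
  fixes f :: "nat \<Rightarrow> nat"
  obtains r :: "nat \<Rightarrow> nat" where "strict_mono r" "mono (f \<circ> r)"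
proof -
  obtain r :: "nat \<Rightarrow> nat" where r: "strict_mono r" "monoseq (\<lambda>n. f (r n))" using seq_monosub by blast
  show ?thesis
  proof (cases "incseq (\<lambda>n. f (r n))")
    case True
    then show ?thesis using r(1) that[of r] by (simp add: comp_def)
  next
    case False
    then have dec: "decseq (\<lambda>n. f (r n))" using r(2) by (simp add: monoseq_iff)
    define m where "m = (LEAST v. \<exists>n. v = f (r n))"
    have "\<exists>n. m = f (r n)" unfolding m_def by (rule LeastI_ex) blast
    then obtain n0 where n0: "m = f (r n0)" by blast
    have least: "m \<le> f (r n)" for n unfolding m_def by (rule Least_le) blast
    have "f (r (n + n0)) = m" for n
      using dec least[of "n + n0"] n0 by (metis decseq_def le_add2 le_antisym)
    moreover have "strict_mono (\<lambda>n. r (n + n0))" using r(1) by (simp add: strict_mono_def)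
    ultimately show ?thesis using that[of "\<lambda>n. r (n + n0)"] by (simp add: comp_def mono_def)
  qed
qed

text \<open>The variables are treated one after another: passing to a further subsequence preserves
  the monotone counts obtained before.\<close>

lemma multiset_seq_mono_subseq:
  fixes F :: "nat \<Rightarrow> 'b multiset"
  assumes "finite V"
  shows "\<exists>r :: nat \<Rightarrow> nat. strict_mono r \<and> (\<forall>v\<in>V. mono (\<lambda>n. count (F (r n)) v))"
  using assms
proof (induction V)
  case empty
  then show ?case by (intro exI[of _ id]) (simp add: strict_mono_def)
next
  case (insert v V)
  then obtain r :: "nat \<Rightarrow> nat" where r: "strict_mono r" "\<And>v. v \<in> V \<Longrightarrow> mono (\<lambda>n. count (F (r n)) v)" by blast
  obtain s :: "nat \<Rightarrow> nat" where s: "strict_mono s" "mono ((\<lambda>n. count (F (r n)) v) \<circ> s)"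
    using nat_seq_mono_subseq[of "\<lambda>n. count (F (r n)) v"] .
  have "mono (\<lambda>n. count (F (r (s n))) w)" if "w \<in> V" for w
    using r(2)[OF that] strict_mono_mono[OF s(1)] by (simp add: mono_def)
  then show ?case using r(1) s by (intro exI[of _ "r \<circ> s"]) (auto simp: comp_def strict_mono_def)
qed

text \<open>\<open>B\<close> consists of the minimal elements of \<open>L\<close> under
  divisibility. If \<open>B\<close> were infinite, an injective sequence in it would have a
  subsequence monotone in every variable, hence two distinct members one of which divides the
  other.\<close>

lemma dickson:
  fixes L :: "'b multiset set"
  assumes "finite V" "\<And>M. M \<in> L \<Longrightarrow> set_mset M \<subseteq> V"
  obtains B where "finite B" "B \<subseteq> L" "\<And>M. M \<in> L \<Longrightarrow> \<exists>A\<in>B. A \<subseteq># M"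
proof
  define B where "B = {M \<in> L. \<forall>A\<in>L. A \<subseteq># M \<longrightarrow> A = M}"
  show "B \<subseteq> L" by (auto simp: B_def)
  show "\<exists>A\<in>B. A \<subseteq># M" if "M \<in> L" for M
    using that
  proof (induction "size M" arbitrary: M rule: less_induct)
    case less
    show ?case
    proof (cases "M \<in> B")
      case False
      then obtain A where A: "A \<in> L" "A \<subseteq># M" "A \<noteq> M" using less by (auto simp: B_def)
      then have "size A < size M" by (simp add: mset_subset_size subset_mset.less_le)
      then show ?thesis using less A by (meson subset_mset.order_trans)
    qed auto
  qed
  show "finite B"
  proof (rule ccontr)
    assume "infinite B"
    then obtain F :: "nat \<Rightarrow> 'b multiset" where F: "inj F" "range F \<subseteq> B"
      using infinite_countable_subset by blast
    obtain r :: "nat \<Rightarrow> nat" where r: "strict_mono r" "\<And>v. v \<in> V \<Longrightarrow> mono (\<lambda>n. count (F (r n)) v)"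
      using multiset_seq_mono_subseq[OF assms(1)] by blast
    have FB: "F n \<in> B" "F n \<in> L" for n using F by (auto simp: B_def)
    have "count (F (r 0)) v \<le> count (F (r 1)) v" for v
    proof (cases "v \<in> V")
      case True then show ?thesis using r(2) by (simp add: mono_def)
    next
      case False
      then have "v \<notin># F (r 0)" using assms(2) FB by blast
      then show ?thesis by (simp add: not_in_iff)
    qed
    then have "F (r 0) \<subseteq># F (r 1)" by (simp add: subseteq_mset_def)
    then have "F (r 0) = F (r 1)" using FB by (auto simp: B_def)
    then have "r 0 = r 1" using F(1) by (simp add: inj_eq)
    then show False using r(1) by (metis less_irrefl strict_mono_def zero_less_one)
  qed
qed

section \<open>Coefficients and leading monomials\<close>

text \<open>\<open>S\<close> is a parameter with a defining equation, declared as structure, so that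
  ring operations without index are those of the power series ring.\<close>

locale power_series = K: field K for K :: "('a, 'm) ring_scheme" +
  fixes d :: nat and S :: "(nat multiset \<Rightarrow> 'a) ring" (structure)
  assumes S_eq: "S = power_series_ring K d"
begin

sublocale cring S
  unfolding S_eq by (rule power_series_ring_cring) (rule K.is_cring)

lemma mem_carrier:
  "f \<in> carrier S \<longleftrightarrow> (\<forall>M. f M \<in> carrier K) \<and> (\<forall>M. \<not> set_mset M \<subseteq> {1..d} \<longrightarrow> f M = \<zero>\<^bsub>K\<^esub>)"
  by (simp add: S_eq power_series_ring_def)

lemma coeff_closed [simp, intro]: "f \<in> carrier S \<Longrightarrow> f M \<in> carrier K"
  by (simp add: mem_carrier)

lemma coeff_vars: "f \<in> carrier S \<Longrightarrow> f M \<noteq> \<zero>\<^bsub>K\<^esub> \<Longrightarrow> set_mset M \<subseteq> {1..d}"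
  by (auto simp: mem_carrier)

lemma coeff_mult: "(f \<otimes> g) M = (\<Oplus>\<^bsub>K\<^esub>A\<in>{A. A \<subseteq># M}. f A \<otimes>\<^bsub>K\<^esub> g (M - A))"
  unfolding S_eq power_series_ring_def by simp

lemma coeff_add [simp]: "(f \<oplus> g) M = f M \<oplus>\<^bsub>K\<^esub> g M"
  unfolding S_eq power_series_ring_def by simp

lemma coeff_zero [simp]: "\<zero> M = \<zero>\<^bsub>K\<^esub>"
  unfolding S_eq power_series_ring_def by simp

lemma coeff_one: "\<one> M = (if M = {#} then \<one>\<^bsub>K\<^esub> else \<zero>\<^bsub>K\<^esub>)"
  unfolding S_eq power_series_ring_def by simp

lemma coeff_uminus [simp]:
  assumes "f \<in> carrier S" shows "(\<ominus> f) M = \<ominus>\<^bsub>K\<^esub> f M"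
proof -
  have "(\<ominus> f \<oplus> f) M = \<zero>\<^bsub>K\<^esub>" using assms l_neg by simp
  then show ?thesis using assms K.minus_equality[of "(\<ominus> f) M" "f M"] by simp
qed

lemma coeff_minus [simp]:
  assumes "f \<in> carrier S" "g \<in> carrier S" shows "(f \<ominus> g) M = f M \<ominus>\<^bsub>K\<^esub> g M"
  using assms by (simp add: a_minus_def)

lemma coeff_finsum:
  assumes "finite B" "F \<in> B \<rightarrow> carrier S"
  shows "(\<Oplus>i\<in>B. F i) M = (\<Oplus>\<^bsub>K\<^esub>i\<in>B. F i M)"
  using assms
proof (induction B)
  case (insert i B)
  then show ?case using K.finsum_insert[of B i "\<lambda>i. F i M"] by (simp add: Pi_def)
qed simp

lemma eq_zero_iff: "f = \<zero> \<longleftrightarrow> (\<forall>M. f M = \<zero>\<^bsub>K\<^esub>)"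
  by (auto simp: fun_eq_iff)

definition cterm :: "'a \<Rightarrow> nat multiset \<Rightarrow> nat multiset \<Rightarrow> 'a"
  where "cterm a A = (\<lambda>M. if M = A then a else \<zero>\<^bsub>K\<^esub>)"

lemma cterm_closed [simp, intro]: "a \<in> carrier K \<Longrightarrow> set_mset A \<subseteq> {1..d} \<Longrightarrow> cterm a A \<in> carrier S"
  by (auto simp: mem_carrier cterm_def)

lemma coeff_cterm_mult:
  assumes "a \<in> carrier K" "f \<in> carrier S"
  shows "(cterm a A \<otimes> f) M = (if A \<subseteq># M then a \<otimes>\<^bsub>K\<^esub> f (M - A) else \<zero>\<^bsub>K\<^esub>)"
proof -
  have "(cterm a A \<otimes> f) M = (\<Oplus>\<^bsub>K\<^esub>B\<in>{B. B \<subseteq># M}. if A = B then a \<otimes>\<^bsub>K\<^esub> f (M - B) else \<zero>\<^bsub>K\<^esub>)"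
    unfolding coeff_mult using assms by (intro K.finsum_cong') (auto simp: cterm_def)
  also have "\<dots> = (if A \<subseteq># M then a \<otimes>\<^bsub>K\<^esub> f (M - A) else \<zero>\<^bsub>K\<^esub>)"
  proof (cases "A \<subseteq># M")
    case True
    then show ?thesis
      using K.finsum_singleton[of A "{B. B \<subseteq># M}" "\<lambda>B. a \<otimes>\<^bsub>K\<^esub> f (M - B)"] assms finite_submultisets[of M] by auto
  next
    case False
    then show ?thesis by (auto intro!: K.add.finprod_one_eqI)
  qed
  finally show ?thesis .
qed

text \<open>The copy of \<open>K\<close> inside \<open>S\<close>, over which dimensions are
  counted.\<close>

definition scalars :: "(nat multiset \<Rightarrow> 'a) set"
  where "scalars = (\<lambda>a. cterm a {#}) ` carrier K"

text \<open>The order is invariant under translation: if \<open>D\<close> exceeds \<open>A\<close>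
  and \<open>N\<close> is at most \<open>A + B\<close>, then \<open>N - D\<close> lies below
  \<open>B\<close>. So every product in the convolution other than the one at \<open>D = A\<close>
  has a factor below its bound and vanishes. \<open>A\<close> and \<open>B\<close> are only lower
  bounds for the supports; the coefficients there may be zero.\<close>

lemma coeff_lead_mult:
  assumes f: "f \<in> carrier S" "\<And>N. mless N A \<Longrightarrow> f N = \<zero>\<^bsub>K\<^esub>"
    and g: "g \<in> carrier S" "\<And>N. mless N B \<Longrightarrow> g N = \<zero>\<^bsub>K\<^esub>"
  shows "(f \<otimes> g) (A + B) = f A \<otimes>\<^bsub>K\<^esub> g B"
    and "mless N (A + B) \<Longrightarrow> (f \<otimes> g) N = \<zero>\<^bsub>K\<^esub>"
proof -
  have key: "f D \<otimes>\<^bsub>K\<^esub> g (N - D) = \<zero>\<^bsub>K\<^esub>" if D: "D \<subseteq># N" "D \<noteq> A" and N: "mless N (A + B) \<or> N = A + B" for D N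
  proof (cases "mless D A")
    case True then show ?thesis using f g by simp
  next
    case False
    then have "mless A D" using D mless_linear by blast
    then have "mless (A + (N - D)) (D + (N - D))" by (simp only: mless_add_right)
    then have "mless (A + (N - D)) (A + B)" using D N mless_trans by auto
    then have "mless (N - D) B" by (simp only: mless_add_left)
    then show ?thesis using f g by simp
  qed
  have "(f \<otimes> g) (A + B) = (\<Oplus>\<^bsub>K\<^esub>D\<in>{D. D \<subseteq># A + B}. if A = D then f D \<otimes>\<^bsub>K\<^esub> g (A + B - D) else \<zero>\<^bsub>K\<^esub>)"
    unfolding coeff_mult using key[of _ "A + B"] f(1) g(1) by (intro K.finsum_cong') auto
  also have "\<dots> = f A \<otimes>\<^bsub>K\<^esub> g B"
    using f(1) g(1) finite_submultisets[of "A + B"]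
    by (subst K.finsum_singleton) auto
  finally show "(f \<otimes> g) (A + B) = f A \<otimes>\<^bsub>K\<^esub> g B" .
  assume N: "mless N (A + B)"
  have "f D \<otimes>\<^bsub>K\<^esub> g (N - D) = \<zero>\<^bsub>K\<^esub>" if D: "D \<subseteq># N" for D
  proof (cases "D = A")
    case True
    then have "mless (A + (N - D)) (A + B)" using D N by auto
    then have "mless (N - D) B" by (simp only: mless_add_left)
    then show ?thesis using f g by simp
  qed (use key D N in blast)
  then show "(f \<otimes> g) N = \<zero>\<^bsub>K\<^esub>" unfolding coeff_mult by (intro K.add.finprod_one_eqI) auto
qed

text \<open>The leading monomial is the least one that occurs, as is usual for power series, and not
  the greatest as for polynomials.\<close>

definition is_lm :: "(nat multiset \<Rightarrow> 'a) \<Rightarrow> nat multiset \<Rightarrow> bool"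
  where "is_lm f M \<longleftrightarrow> f M \<noteq> \<zero>\<^bsub>K\<^esub> \<and> (\<forall>N. mless N M \<longrightarrow> f N = \<zero>\<^bsub>K\<^esub>)"

lemma ex_lm: assumes "f \<noteq> \<zero>" shows "\<exists>M. is_lm f M"
proof -
  obtain M0 where "f M0 \<noteq> \<zero>\<^bsub>K\<^esub>" using assms eq_zero_iff by blast
  then obtain M where "f M \<noteq> \<zero>\<^bsub>K\<^esub>" "\<And>N. mless N M \<Longrightarrow> f N = \<zero>\<^bsub>K\<^esub>"
    using wfE_min[OF wf_mless, of M0 "{M. f M \<noteq> \<zero>\<^bsub>K\<^esub>}"] by auto
  then show ?thesis by (auto simp: is_lm_def)
qed

lemma is_lm_mult:
  assumes "f \<in> carrier S" "g \<in> carrier S" "is_lm f A" "is_lm g B"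
  shows "is_lm (f \<otimes> g) (A + B)"
  using assms coeff_lead_mult[of f A g B] K.integral[of "f A" "g B"] by (auto simp: is_lm_def)

text \<open>Leading monomials multiply, so a product of nonzero series has a leading
  monomial.\<close>

sublocale "domain" S
proof
  have "\<one> {#} \<noteq> \<zero> {#}" by (simp add: coeff_one)
  then show "\<one> \<noteq> \<zero>" by metis
  fix f g assume h: "f \<otimes> g = \<zero>" "f \<in> carrier S" "g \<in> carrier S"
  show "f = \<zero> \<or> g = \<zero>"
  proof (rule ccontr)
    assume "\<not> (f = \<zero> \<or> g = \<zero>)"
    then obtain A B where "is_lm f A" "is_lm g B" using ex_lm by blast
    then have "is_lm (f \<otimes> g) (A + B)" using is_lm_mult h by blast
    then show False using h by (simp add: is_lm_def)
  qed
qed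

lemma scalars_subfield: "subfield scalars S"
proof -
  have "ring_hom_ring K S (\<lambda>a. cterm a {#})"
  proof (rule ring_hom_ringI)
    show "\<And>a. a \<in> carrier K \<Longrightarrow> cterm a {#} \<in> carrier S" by simp
    fix a b assume ab: "a \<in> carrier K" "b \<in> carrier K"
    show "cterm (a \<otimes>\<^bsub>K\<^esub> b) {#} = cterm a {#} \<otimes> cterm b {#}"
      using ab by (intro ext) (auto simp: coeff_cterm_mult, auto simp: cterm_def)
    show "cterm (a \<oplus>\<^bsub>K\<^esub> b) {#} = cterm a {#} \<oplus> cterm b {#}"
      using ab by (intro ext) (auto simp: cterm_def)
  qed (auto simp: K.ring_axioms ring_axioms cterm_def coeff_one fun_eq_iff)
  then interpret h: ring_hom_ring K S "\<lambda>a. cterm a {#}" .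
  have "subfield (carrier K) K" by (simp add: K.carrier_is_subfield)
  then show ?thesis unfolding scalars_def
    using h.img_is_subfield(2) by simp
qed

text \<open>The \<open>n\<close>-th power of the maximal ideal, described by order of vanishing; the
  index 0 gives the whole ring.\<close>

definition ord_ideal :: "nat \<Rightarrow> (nat multiset \<Rightarrow> 'a) set"
  where "ord_ideal n = {f \<in> carrier S. \<forall>M. size M < n \<longrightarrow> f M = \<zero>\<^bsub>K\<^esub>}"

lemma ord_ideal_mult:
  assumes "f \<in> ord_ideal m" "g \<in> ord_ideal n" shows "f \<otimes> g \<in> ord_ideal (m + n)"
proof -
  have c: "f \<in> carrier S" "g \<in> carrier S" using assms by (auto simp: ord_ideal_def)
  have "f D \<otimes>\<^bsub>K\<^esub> g (N - D) = \<zero>\<^bsub>K\<^esub>" if "D \<subseteq># N" "size N < m + n" for D N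
  proof (cases "size D < m")
    case True then show ?thesis using assms c by (simp add: ord_ideal_def)
  next
    case False
    have "size D \<le> size N" using that by (simp add: size_mset_mono)
    with False have "size (N - D) < n" using that by (simp add: size_Diff_submset)
    then show ?thesis using assms c by (simp add: ord_ideal_def)
  qed
  then have "(f \<otimes> g) N = \<zero>\<^bsub>K\<^esub>" if "size N < m + n" for N
    unfolding coeff_mult using that by (intro K.add.finprod_one_eqI) auto
  then show ?thesis using c by (auto simp: ord_ideal_def)
qed

lemma ord_ideal_0: "ord_ideal 0 = carrier S"
  by (auto simp: ord_ideal_def)

lemma ord_ideal_antimono: "m \<le> n \<Longrightarrow> ord_ideal n \<subseteq> ord_ideal m"
  by (auto simp: ord_ideal_def)

lemma ord_ideal_pow: "f \<in> ord_ideal 1 \<Longrightarrow> f [^] (n::nat) \<in> ord_ideal n"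
proof (induction n)
  case 0 then show ?case by (simp add: ord_ideal_0)
next
  case (Suc n)
  then show ?case using ord_ideal_mult[of "f [^] n" n f 1] by simp
qed

lemma ord_ideal_ideal: "ideal (ord_ideal n) S"
proof (rule idealI[OF ring_axioms])
  show "subgroup (ord_ideal n) (add_monoid S)"
  proof
    fix f assume f: "f \<in> ord_ideal n"
    have "\<ominus> f \<in> ord_ideal n" using f by (auto simp: ord_ideal_def)
    then show "inv\<^bsub>add_monoid S\<^esub> f \<in> ord_ideal n" by (simp add: a_inv_def)
  qed (auto simp: ord_ideal_def)
  fix f g assume "f \<in> ord_ideal n" "g \<in> carrier S"
  then show "g \<otimes> f \<in> ord_ideal n" "f \<otimes> g \<in> ord_ideal n"
    using ord_ideal_mult[of f n g 0] ord_ideal_mult[of g 0 f n] by (auto simp: ord_ideal_0)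
qed

definition lms :: "(nat multiset \<Rightarrow> 'a) set \<Rightarrow> nat multiset set"
  where "lms I = {M. \<exists>f\<in>I. is_lm f M}"

lemma lms_vars: "I \<subseteq> carrier S \<Longrightarrow> M \<in> lms I \<Longrightarrow> set_mset M \<subseteq> {1..d}"
  using coeff_vars by (auto simp: lms_def is_lm_def)

lemma lms_monic:
  assumes "ideal I S" "M \<in> lms I"
  shows "\<exists>f\<in>I. is_lm f M \<and> f M = \<one>\<^bsub>K\<^esub>"
proof -
  interpret I: ideal I S by fact
  obtain f where f: "f \<in> I" "is_lm f M" using assms by (auto simp: lms_def)
  then have fc: "f \<in> carrier S" using I.Icarr by blast
  have u: "f M \<in> Units K" using f fc K.field_Units by (auto simp: is_lm_def)
  let ?g = "cterm (inv\<^bsub>K\<^esub> f M) {#} \<otimes> f"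
  have 1: "?g N = inv\<^bsub>K\<^esub> f M \<otimes>\<^bsub>K\<^esub> f N" for N
    using coeff_cterm_mult[of "inv\<^bsub>K\<^esub> f M" f "{#}" N] fc u by simp
  have "?g \<in> I" using f u by (intro I.I_l_closed) auto
  moreover have g1: "?g M = \<one>\<^bsub>K\<^esub>" using 1 u by simp
  moreover have "is_lm ?g M" using g1 1 f u by (auto simp: is_lm_def)
  ultimately show ?thesis by blast
qed

lemma lms_add:
  assumes "ideal I S" "M \<in> lms I" "set_mset A \<subseteq> {1..d}"
  shows "A + M \<in> lms I"
proof -
  interpret I: ideal I S by fact
  obtain f where f: "f \<in> I" "is_lm f M" using assms by (auto simp: lms_def)
  have "is_lm (cterm \<one>\<^bsub>K\<^esub> A) A" by (auto simp: is_lm_def cterm_def)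
  then have "is_lm (cterm \<one>\<^bsub>K\<^esub> A \<otimes> f) (A + M)"
    using f assms I.Icarr by (intro is_lm_mult) auto
  then show ?thesis using f assms I.I_l_closed[of f "cterm \<one>\<^bsub>K\<^esub> A"] by (auto simp: lms_def)
qed

section \<open>Division by a standard basis\<close>

text \<open>Every leading monomial \<open>N\<close> of \<open>I\<close> is assigned a divisor \<open>\<beta> N\<close> from the Dickson basis \<open>B\<close>.
  The coefficients \<open>c N\<close> with which the shifted basis elements occur are determined by well-founded
  recursion on \<open>N\<close>, so no limit process is needed.\<close>

theorem division:
  assumes I: "ideal I S"
  obtains B :: "nat multiset set" and F where "finite B" "F \<in> B \<rightarrow> I"
    "\<forall>n. \<forall>z\<in>ord_ideal n. \<exists>q w. (\<forall>A\<in>B. q A \<in> ord_ideal (n - size A)) \<and> w \<in> carrier S \<and>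
       (\<forall>M\<in>lms I. w M = \<zero>\<^bsub>K\<^esub>) \<and> z = (\<Oplus>A\<in>B. q A \<otimes> F A) \<oplus> w"
proof -
  interpret I: ideal I S by fact
  let ?L = "lms I"
  have Lv: "set_mset M \<subseteq> {1..d}" if "M \<in> ?L" for M using that lms_vars[OF I.a_subset] by blast
  obtain B where B: "finite B" "B \<subseteq> ?L" "\<And>M. M \<in> ?L \<Longrightarrow> \<exists>A\<in>B. A \<subseteq># M"
    using dickson[of "{1..d}" ?L] Lv by blast
  obtain \<beta> where \<beta>: "\<And>M. M \<in> ?L \<Longrightarrow> \<beta> M \<in> B \<and> \<beta> M \<subseteq># M" using B(3) by metis
  have "\<forall>A\<in>B. \<exists>f\<in>I. is_lm f A \<and> f A = \<one>\<^bsub>K\<^esub>" using lms_monic[OF I] B(2) by blast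
  then obtain F where F: "\<And>A. A \<in> B \<Longrightarrow> F A \<in> I \<and> is_lm (F A) A \<and> F A A = \<one>\<^bsub>K\<^esub>" by metis
  have Fc: "F A \<in> carrier S" if "A \<in> B" for A using F[OF that] I.Icarr by blast
  have F0: "F A N = \<zero>\<^bsub>K\<^esub>" if "A \<in> B" "mless N A" for A N using F that by (auto simp: is_lm_def)
  have "\<exists>q w. (\<forall>A\<in>B. q A \<in> ord_ideal (n - size A)) \<and> w \<in> carrier S \<and>
       (\<forall>M\<in>?L. w M = \<zero>\<^bsub>K\<^esub>) \<and> z = (\<Oplus>A\<in>B. q A \<otimes> F A) \<oplus> w" if z: "z \<in> ord_ideal n" for n z
  proof -
    have zc: "z \<in> carrier S" using z by (simp add: ord_ideal_def)
    \<comment> \<open>Compare coefficients at \<open>N\<close> in the desired equation for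
      \<open>z\<close>: the pair \<open>A = \<beta> N\<close>, \<open>D = N - \<beta> N\<close>
      contributes \<open>c N\<close>, as \<open>F A\<close> is monic, and every other pair involves
      \<open>c\<close> at a smaller monomial or vanishes. Solving for \<open>c N\<close> gives
      \<open>G\<close>; the guard \<open>mless (D + A) N\<close> makes the recursion
      well-founded.\<close>
    define G where "G c N = (if N \<in> ?L then z N \<ominus>\<^bsub>K\<^esub> (\<Oplus>\<^bsub>K\<^esub>A\<in>B. \<Oplus>\<^bsub>K\<^esub>D\<in>{D. D \<subseteq># N}.
       (if mless (D + A) N \<and> D + A \<in> ?L \<and> \<beta> (D + A) = A then c (D + A) else \<zero>\<^bsub>K\<^esub>) \<otimes>\<^bsub>K\<^esub> F A (N - D))
       else \<zero>\<^bsub>K\<^esub>)" for c N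
    define c where "c = wfrec {(M, N). mless M N} G"
    have c: "c N = G c N" for N
    proof -
      have "c N = G (cut c {(M, N). mless M N} N) N" unfolding c_def by (rule wfrec[OF wf_mless])
      also have "\<dots> = G c N"
        unfolding G_def by (simp add: cut_apply cong: if_cong conj_cong)
      finally show ?thesis .
    qed
    have cc: "c N \<in> carrier K" for N
    proof (induction N rule: wf_induct_rule[OF wf_mless])
      case (1 N)
      then show ?case
        unfolding c[of N] G_def using zc Fc by (auto intro!: K.minus_closed K.finsum_closed)
    qed
    \<comment> \<open>A monomial smaller in \<open>mless\<close> has no larger size, so below degree
      \<open>n\<close> the recursion meets only zeros. This bounds the order of the
      quotients.\<close>
    have c0: "size N < n \<Longrightarrow> c N = \<zero>\<^bsub>K\<^esub>" for N
    proof (induction N rule: wf_induct_rule[OF wf_mless])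
      case (1 N)
      have IH: "c y = \<zero>\<^bsub>K\<^esub>" if "mless y N" for y
        using 1 that mless_size[OF that] by simp
      have "(\<Oplus>\<^bsub>K\<^esub>A\<in>B. \<Oplus>\<^bsub>K\<^esub>D\<in>{D. D \<subseteq># N}.
       (if mless (D + A) N \<and> D + A \<in> ?L \<and> \<beta> (D + A) = A then c (D + A) else \<zero>\<^bsub>K\<^esub>) \<otimes>\<^bsub>K\<^esub> F A (N - D)) = \<zero>\<^bsub>K\<^esub>"
        using IH Fc by (intro K.add.finprod_one_eqI) auto
      moreover have "z N = \<zero>\<^bsub>K\<^esub>" using z 1 by (simp add: ord_ideal_def)
      ultimately show ?case unfolding c[of N] G_def by (simp add: a_minus_def)
    qed
    \<comment> \<open>The quotient belonging to \<open>A\<close> collects exactly those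
      \<open>c N\<close> whose assigned divisor is \<open>A\<close>, shifted down by
      \<open>A\<close>.\<close>
    define q where "q A D = (if D + A \<in> ?L \<and> \<beta> (D + A) = A then c (D + A) else \<zero>\<^bsub>K\<^esub>)" for A D
    have qc: "q A \<in> carrier S" for A
      unfolding mem_carrier q_def using cc Lv by (auto simp: subset_eq)
    have qo: "q A \<in> ord_ideal (n - size A)" for A
      using qc c0 by (auto simp: ord_ideal_def q_def)
    define w where "w = z \<ominus> (\<Oplus>A\<in>B. q A \<otimes> F A)"
    have sc: "(\<Oplus>A\<in>B. q A \<otimes> F A) \<in> carrier S" using qc Fc by (intro finsum_closed) auto
    have w0: "w N = \<zero>\<^bsub>K\<^esub>" if N: "N \<in> ?L" for N
    proof -
      let ?r = "\<lambda>A D. (if mless (D + A) N \<and> D + A \<in> ?L \<and> \<beta> (D + A) = A then c (D + A) else \<zero>\<^bsub>K\<^esub>) \<otimes>\<^bsub>K\<^esub> F A (N - D)"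
      let ?e = "\<lambda>A D. if \<beta> N = A then (if N - \<beta> N = D then c N else \<zero>\<^bsub>K\<^esub>) else \<zero>\<^bsub>K\<^esub>"
      \<comment> \<open>\<open>?r\<close> is the part already covered by the recursion and
        \<open>?e\<close> the new term at \<open>N\<close>. Pairs with \<open>D + A\<close> above
        \<open>N\<close> contribute nothing, since then \<open>N - D\<close> lies below the leading
        monomial \<open>A\<close> of \<open>F A\<close>.\<close>
      have split: "q A D \<otimes>\<^bsub>K\<^esub> F A (N - D) = ?r A D \<oplus>\<^bsub>K\<^esub> ?e A D" if A: "A \<in> B" and D: "D \<subseteq># N" for A D
      proof -
        consider "mless (D + A) N" | "D + A = N" | "mless N (D + A)" using mless_linear by blast
        then show ?thesis
        proof cases
          case 1
          then have "\<not> (\<beta> N = A \<and> N - \<beta> N = D)" using \<beta>[OF N] by auto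
          then show ?thesis using 1 cc Fc[OF A] by (auto simp: q_def)
        next
          case 2
          then have ND: "N - D = A" "N - A = D" by auto
          then show ?thesis using 2 N cc Fc[OF A] F[OF A] by (auto simp: q_def)
        next
          case 3
          then have nl: "\<not> mless (D + A) N" using mless_trans mless_irrefl by blast
          have "mless (D + (N - D)) (D + A)" using 3 D by simp
          then have "mless (N - D) A" by (simp only: mless_add_left)
          then have "F A (N - D) = \<zero>\<^bsub>K\<^esub>" using F0 A by blast
          moreover have "\<not> (\<beta> N = A \<and> N - \<beta> N = D)" using 3 \<beta>[OF N] by auto
          ultimately show ?thesis using nl cc Fc[OF A] by (auto simp: q_def)
        qed
      qed
      have rc: "?r A D \<in> carrier K" if "A \<in> B" for A D using cc Fc[OF that] by auto
      have ec: "?e A D \<in> carrier K" for A D using cc by auto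
      have "(\<Oplus>A\<in>B. q A \<otimes> F A) N = (\<Oplus>\<^bsub>K\<^esub>A\<in>B. (q A \<otimes> F A) N)"
        using B(1) qc Fc by (intro coeff_finsum) auto
      also have "\<dots> = (\<Oplus>\<^bsub>K\<^esub>A\<in>B. (\<Oplus>\<^bsub>K\<^esub>D\<in>{D. D \<subseteq># N}. ?r A D) \<oplus>\<^bsub>K\<^esub> (\<Oplus>\<^bsub>K\<^esub>D\<in>{D. D \<subseteq># N}. ?e A D))"
      proof (rule K.finsum_cong')
        fix A assume A: "A \<in> B"
        have "(q A \<otimes> F A) N = (\<Oplus>\<^bsub>K\<^esub>D\<in>{D. D \<subseteq># N}. ?r A D \<oplus>\<^bsub>K\<^esub> ?e A D)"
          unfolding coeff_mult using split[OF A] rc[OF A] ec by (intro K.finsum_cong') auto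
        also have "\<dots> = (\<Oplus>\<^bsub>K\<^esub>D\<in>{D. D \<subseteq># N}. ?r A D) \<oplus>\<^bsub>K\<^esub> (\<Oplus>\<^bsub>K\<^esub>D\<in>{D. D \<subseteq># N}. ?e A D)"
          using rc[OF A] ec by (intro K.finsum_addf) auto
        finally show "(q A \<otimes> F A) N = (\<Oplus>\<^bsub>K\<^esub>D\<in>{D. D \<subseteq># N}. ?r A D) \<oplus>\<^bsub>K\<^esub> (\<Oplus>\<^bsub>K\<^esub>D\<in>{D. D \<subseteq># N}. ?e A D)" .
      qed (use rc ec in \<open>auto intro!: K.add.m_closed K.finsum_closed\<close>)
      also have "\<dots> = (\<Oplus>\<^bsub>K\<^esub>A\<in>B. \<Oplus>\<^bsub>K\<^esub>D\<in>{D. D \<subseteq># N}. ?r A D) \<oplus>\<^bsub>K\<^esub> (\<Oplus>\<^bsub>K\<^esub>A\<in>B. \<Oplus>\<^bsub>K\<^esub>D\<in>{D. D \<subseteq># N}. ?e A D)"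
        using rc ec by (intro K.finsum_addf) (auto intro!: K.finsum_closed)
      also have "(\<Oplus>\<^bsub>K\<^esub>A\<in>B. \<Oplus>\<^bsub>K\<^esub>D\<in>{D. D \<subseteq># N}. ?e A D) = (\<Oplus>\<^bsub>K\<^esub>A\<in>B. if \<beta> N = A then c N else \<zero>\<^bsub>K\<^esub>)"
      proof (rule K.finsum_cong')
        fix A assume A: "A \<in> B"
        have mem: "N - \<beta> N \<in> {D. D \<subseteq># N}" by simp
        have "(\<Oplus>\<^bsub>K\<^esub>D\<in>{D. D \<subseteq># N}. if N - \<beta> N = D then c N else \<zero>\<^bsub>K\<^esub>) = c N"
          using K.finsum_singleton[OF mem finite_submultisets, of "\<lambda>_. c N"] cc by simp
        then show "(\<Oplus>\<^bsub>K\<^esub>D\<in>{D. D \<subseteq># N}. ?e A D) = (if \<beta> N = A then c N else \<zero>\<^bsub>K\<^esub>)"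
          by (cases "\<beta> N = A") simp_all
      qed (use cc in auto)
      also have "\<dots> = c N"
        using K.finsum_singleton[of "\<beta> N" B "\<lambda>_. c N"] \<beta>[OF N] B(1) cc by simp
      finally have e: "(\<Oplus>A\<in>B. q A \<otimes> F A) N = (\<Oplus>\<^bsub>K\<^esub>A\<in>B. \<Oplus>\<^bsub>K\<^esub>D\<in>{D. D \<subseteq># N}. ?r A D) \<oplus>\<^bsub>K\<^esub> c N" .
      define s where "s = (\<Oplus>\<^bsub>K\<^esub>A\<in>B. \<Oplus>\<^bsub>K\<^esub>D\<in>{D. D \<subseteq># N}. ?r A D)"
      have scl: "s \<in> carrier K" unfolding s_def using rc by (auto intro!: K.finsum_closed)
      have "c N = z N \<ominus>\<^bsub>K\<^esub> s" unfolding c[of N] G_def s_def using N by simp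
      then have "s \<oplus>\<^bsub>K\<^esub> c N = z N" using scl zc
        by (simp add: a_minus_def K.a_comm[of "z N"] K.r_neg2)
      then have "(\<Oplus>A\<in>B. q A \<otimes> F A) N = z N" using e by (simp add: s_def)
      then show ?thesis using zc sc by (simp add: w_def a_minus_def K.r_neg)
    qed
    have "z = (\<Oplus>A\<in>B. q A \<otimes> F A) \<oplus> w" unfolding w_def using zc sc
      by (simp add: a_minus_def a_comm[of z] r_neg2)
    then show ?thesis using qo w0 zc sc by (intro exI[of _ q] exI[of _ w]) (auto simp: w_def)
  qed
  with B(1) F show ?thesis using that[of B F] by auto
qed

end

section \<open>Sums of ideals, and generators adjoined one at a time\<close>

lemma (in ideal) finsum_mem:
  assumes "finite B" "F \<in> B \<rightarrow> I" shows "(\<Oplus>i\<in>B. F i) \<in> I"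
  using assms
proof (induction B)
  case (insert i B)
  then have "F i \<in> carrier R" "F \<in> B \<rightarrow> carrier R" using Icarr by (auto simp: Pi_def)
  then show ?case using insert by (subst finsum_insert) auto
qed simp

lemma (in ring) mem_add_ideals_iff:
  "z \<in> I <+>\<^bsub>R\<^esub> J \<longleftrightarrow> (\<exists>a\<in>I. \<exists>b\<in>J. z = a \<oplus> b)"
  by (auto simp: set_add_def')

lemma (in ring) add_ideals_right:
  assumes "ideal I R" "J \<subseteq> carrier R" shows "J \<subseteq> I <+>\<^bsub>R\<^esub> J"
proof
  interpret I: ideal I R by fact
  fix b assume "b \<in> J"
  then show "b \<in> I <+>\<^bsub>R\<^esub> J" using assms(2) unfolding mem_add_ideals_iff
    by (intro bexI[of _ \<zero>] bexI[of _ b]) auto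
qed

lemma (in ring) add_ideals_left:
  assumes "ideal J R" "I \<subseteq> carrier R" shows "I \<subseteq> I <+>\<^bsub>R\<^esub> J"
proof
  interpret J: ideal J R by fact
  fix b assume "b \<in> I"
  then show "b \<in> I <+>\<^bsub>R\<^esub> J" using assms(2) unfolding mem_add_ideals_iff
    by (intro bexI[of _ \<zero>] bexI[of _ b]) auto
qed

lemma (in ring) add_ideals_least:
  assumes "ideal L R" "I \<subseteq> L" "J \<subseteq> L" shows "I <+>\<^bsub>R\<^esub> J \<subseteq> L"
proof -
  interpret L: ideal L R by fact
  show ?thesis using assms(2,3) by (auto simp: mem_add_ideals_iff intro!: L.a_closed)
qed

lemma (in ring) span_mod_mono: "U \<subseteq> V \<Longrightarrow> span_mod k U us \<subseteq> span_mod k V us"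
  unfolding span_mod_def by blast

text \<open>The ideal generated by \<open>U\<close> and \<open>fs\<close>, built from principal
  ideals so that an induction on \<open>fs\<close> can remove one generator at a time.\<close>

fun (in ring) gen_mod :: "'a set \<Rightarrow> 'a list \<Rightarrow> 'a set"
  where
    "gen_mod U [] = U"
  | "gen_mod U (f # fs) = gen_mod U fs <+>\<^bsub>R\<^esub> PIdl f"

lemma (in cring) gen_mod_ideal:
  assumes "ideal U R" "set fs \<subseteq> carrier R" shows "ideal (gen_mod U fs) R"
  using assms by (induction fs) (auto intro: add_ideals cgenideal_ideal)

lemma (in cring) gen_mod_superset:
  assumes "ideal U R" "set fs \<subseteq> carrier R" shows "Idl (set fs) <+>\<^bsub>R\<^esub> U \<subseteq> gen_mod U fs"
proof -
  have "U \<subseteq> gen_mod U fs \<and> set fs \<subseteq> gen_mod U fs"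
    using assms
  proof (induction fs)
    case (Cons f fs)
    have i: "ideal (gen_mod U fs) R" "ideal (PIdl f) R"
      using Cons.prems by (auto intro: gen_mod_ideal cgenideal_ideal)
    have "gen_mod U fs \<subseteq> gen_mod U (f # fs)" "PIdl f \<subseteq> gen_mod U (f # fs)"
      using add_ideals_left[OF i(2)] add_ideals_right[OF i(1)] i[THEN ideal.axioms(1), THEN additive_subgroup.a_subset]
      by auto
    then show ?case using Cons cgenideal_self[of f] by auto
  qed (use ideal.axioms(1) in auto)
  then show ?thesis using gen_mod_ideal[OF assms]
    by (intro add_ideals_least genideal_minimal) auto
qed

text \<open>Removing one \<open>f\<close> from the modulus multiplies the number of generators by
  \<open>n\<close>, because \<open>f [^] n\<close> lies in \<open>U\<close>. This is the upper bound
  in the dimension count.\<close>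

lemma (in cring) span_mod_gen_mod:
  assumes k: "k \<subseteq> carrier R" and U: "ideal U R"
    and fs: "set fs \<subseteq> carrier R" "\<And>f. f \<in> set fs \<Longrightarrow> f [^] (n::nat) \<in> U"
    and gs: "set gs \<subseteq> carrier R" "span_mod k (gen_mod U fs) gs = carrier R"
  shows "\<exists>hs. length hs = n ^ length fs * length gs \<and> set hs \<subseteq> carrier R \<and> span_mod k U hs = carrier R"
  using fs gs
proof (induction fs arbitrary: gs)
  case Nil
  then show ?case by (intro exI[of _ gs]) auto
next
  case (Cons f fs)
  let ?U = "gen_mod U fs"
  have fc: "f \<in> carrier R" "set fs \<subseteq> carrier R" using Cons.prems by auto
  have Ui: "ideal ?U R" using gen_mod_ideal[OF U fc(2)] .
  then interpret V: ideal ?U R .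
  have "U \<subseteq> Idl (set fs) <+>\<^bsub>R\<^esub> U"
    by (rule add_ideals_right[OF genideal_ideal[OF fc(2)] additive_subgroup.a_subset[OF ideal.axioms(1)[OF U]]])
  then have "U \<subseteq> ?U" using gen_mod_superset[OF U fc(2)] by blast
  then have fn: "f [^] n \<in> ?U" using Cons.prems by auto
  have "span_mod k ?U (power_multiples f gs n) = carrier R"
  proof (rule span_mod_power_multiples[OF k Ui fc(1) fn Cons.prems(3)])
    fix z assume z: "z \<in> carrier R"
    then obtain Ks where Ks: "length Ks = length gs" "set Ks \<subseteq> k" "z \<ominus> combine Ks gs \<in> gen_mod U (f # fs)"
      using Cons.prems(4) by (auto simp: span_mod_def)
    then obtain u y where u: "u \<in> ?U" "y \<in> carrier R" "z \<ominus> combine Ks gs = u \<oplus> y \<otimes> f"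
      by (auto simp: mem_add_ideals_iff cgenideal_def)
    have eq: "z \<ominus> combine Ks gs \<ominus> f \<otimes> y = u"
      using u fc V.Icarr by (simp add: a_minus_def a_assoc m_comm r_neg)
    show "\<exists>Ks y. length Ks = length gs \<and> set Ks \<subseteq> k \<and> y \<in> carrier R \<and> z \<ominus> combine Ks gs \<ominus> f \<otimes> y \<in> ?U"
      using Ks(1,2) u(1,2) eq by (intro exI[of _ Ks] exI[of _ y]) simp
  qed
  then obtain hs where "length hs = n ^ length fs * length (power_multiples f gs n)"
    "set hs \<subseteq> carrier R" "span_mod k U hs = carrier R"
    using Cons.IH[of "power_multiples f gs n"] fc Cons.prems power_multiples_closed by auto
  then show ?case by (intro exI[of _ hs]) auto
qed

section \<open>Artin--Rees and chains of primes\<close>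

context power_series
begin

text \<open>Let \<open>x \<otimes> y\<close> be congruent modulo \<open>p\<close> to
  \<open>z\<close> of order \<open>n\<close>. Then \<open>z\<close> lies in the ideal generated by
  \<open>p\<close> and \<open>x\<close>, and division by a standard basis of that ideal writes it as
  \<open>h \<oplus> g \<otimes> x\<close> with \<open>h\<close> in \<open>p\<close> and
  \<open>g\<close> of order at least \<open>n - c\<close>. Hence
  \<open>x \<otimes> (y \<ominus> g)\<close> lies in \<open>p\<close>, and so does
  \<open>y \<ominus> g\<close> by primality.\<close>

lemma artin_rees:
  assumes p: "primeideal p S" and x: "x \<in> carrier S" "x \<notin> p"
  obtains c where "\<And>n y. y \<in> carrier S \<Longrightarrow> x \<otimes> y \<in> p <+>\<^bsub>S\<^esub> ord_ideal n \<Longrightarrow> y \<in> p <+>\<^bsub>S\<^esub> ord_ideal (n - c)"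
proof -
  interpret p: primeideal p S by fact
  let ?I = "p <+>\<^bsub>S\<^esub> PIdl x"
  have Ix: "ideal (PIdl x) S" using x(1) by (rule cgenideal_ideal)
  have I: "ideal ?I S" by (rule add_ideals[OF p.is_ideal Ix])
  then interpret I: ideal ?I S .
  obtain B :: "nat multiset set" and F where B: "finite B" "F \<in> B \<rightarrow> ?I"
    and div: "\<forall>n. \<forall>z\<in>ord_ideal n. \<exists>q w. (\<forall>A\<in>B. q A \<in> ord_ideal (n - size A)) \<and> w \<in> carrier S \<and>
       (\<forall>M\<in>lms ?I. w M = \<zero>\<^bsub>K\<^esub>) \<and> z = (\<Oplus>A\<in>B. q A \<otimes> F A) \<oplus> w"
    by (rule division[OF I]) (rule that)
  have "\<forall>A\<in>B. \<exists>b a. b \<in> p \<and> a \<in> carrier S \<and> F A = b \<oplus> a \<otimes> x"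
  proof
    fix A assume "A \<in> B"
    then have "F A \<in> ?I" using B(2) by blast
    then obtain b c where "b \<in> p" "c \<in> PIdl x" "F A = b \<oplus> c" unfolding mem_add_ideals_iff by blast
    then show "\<exists>b a. b \<in> p \<and> a \<in> carrier S \<and> F A = b \<oplus> a \<otimes> x" unfolding cgenideal_def by blast
  qed
  then obtain b a where ba: "\<And>A. A \<in> B \<Longrightarrow> b A \<in> p \<and> a A \<in> carrier S \<and> F A = b A \<oplus> a A \<otimes> x"
    by metis
  \<comment> \<open>Any common bound for the degrees of the basis monomials would do; the sum is
    one.\<close>
  define c where "c = (\<Sum>A\<in>B. size A)"
  show ?thesis
  proof (rule that[of c])
    fix n y assume y: "y \<in> carrier S" "x \<otimes> y \<in> p <+>\<^bsub>S\<^esub> ord_ideal n"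
    then obtain e z where e: "e \<in> p" "z \<in> ord_ideal n" "x \<otimes> y = e \<oplus> z" by (auto simp: mem_add_ideals_iff)
    have zc: "z \<in> carrier S" using e by (auto simp: ord_ideal_def)
    have ec: "e \<in> carrier S" using e p.Icarr by auto
    have zeq: "z = (\<ominus> e) \<oplus> y \<otimes> x"
      using e(3) zc ec x y by (metis a_comm m_comm r_neg2 a_inv_closed add.m_closed)
    have "y \<otimes> x \<in> PIdl x" using y by (auto simp: cgenideal_def)
    then have zI: "z \<in> ?I" unfolding zeq using e by (auto simp: mem_add_ideals_iff)
    obtain q w where q: "\<And>A. A \<in> B \<Longrightarrow> q A \<in> ord_ideal (n - size A)" and w: "w \<in> carrier S"
       "\<And>M. M \<in> lms ?I \<Longrightarrow> w M = \<zero>\<^bsub>K\<^esub>" "z = (\<Oplus>A\<in>B. q A \<otimes> F A) \<oplus> w"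
      using div[rule_format, OF e(2)] by blast
    have qc: "q A \<in> carrier S" if "A \<in> B" for A using q[OF that] by (simp add: ord_ideal_def)
    have bc: "b A \<in> carrier S" "a A \<in> carrier S" if "A \<in> B" for A using ba[OF that] p.Icarr by auto
    have sI: "(\<Oplus>A\<in>B. q A \<otimes> F A) \<in> ?I"
      using B qc by (intro I.finsum_mem) (auto intro!: I.I_l_closed)
    then have sc: "(\<Oplus>A\<in>B. q A \<otimes> F A) \<in> carrier S" by (rule I.Icarr)
    have "w = z \<ominus> (\<Oplus>A\<in>B. q A \<otimes> F A)"
      using w sc by (simp add: a_minus_def a_comm[of _ w] a_assoc r_neg)
    then have "w \<in> ?I" using zI sI I.minus_mem by simp
    \<comment> \<open>A nonzero \<open>w\<close> would have its leading monomial in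
      \<open>lms ?I\<close>, where its coefficients vanish.\<close>
    then have "w = \<zero>" using ex_lm[of w] w(2) by (auto simp: lms_def is_lm_def)
    then have zs: "z = (\<Oplus>A\<in>B. q A \<otimes> F A)" using w sc by simp
    define g where "g = (\<Oplus>A\<in>B. q A \<otimes> a A)"
    define h where "h = (\<Oplus>A\<in>B. q A \<otimes> b A)"
    have hp: "h \<in> p" unfolding h_def using B qc ba by (intro p.finsum_mem) (auto intro!: p.I_l_closed)
    interpret O: ideal "ord_ideal (n - c)" S by (rule ord_ideal_ideal)
    have go: "g \<in> ord_ideal (n - c)"
      unfolding g_def
    proof (rule O.finsum_mem[OF B(1)], rule funcsetI)
      fix A assume A: "A \<in> B"
      then have "size A \<le> c" unfolding c_def using B(1) by (intro member_le_sum) auto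
      then have "q A \<in> ord_ideal (n - c)" using q[OF A] ord_ideal_antimono[OF diff_le_mono2] by blast
      then show "q A \<otimes> a A \<in> ord_ideal (n - c)" using bc[OF A] O.I_r_closed by blast
    qed
    have gc: "g \<in> carrier S" "h \<in> carrier S" using O.Icarr[OF go] p.Icarr[OF hp] by simp_all
    have "z = (\<Oplus>A\<in>B. q A \<otimes> b A \<oplus> (q A \<otimes> a A) \<otimes> x)"
      unfolding zs using qc bc ba x by (intro finsum_cong') (auto simp: r_distr m_assoc)
    also have "\<dots> = h \<oplus> (\<Oplus>A\<in>B. (q A \<otimes> a A) \<otimes> x)"
      unfolding h_def using qc bc x by (intro finsum_addf) auto
    also have "(\<Oplus>A\<in>B. (q A \<otimes> a A) \<otimes> x) = g \<otimes> x"
      unfolding g_def using qc bc x B by (intro finsum_ldistr[symmetric]) auto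
    finally have z2: "z = h \<oplus> g \<otimes> x" .
    have "x \<otimes> (y \<ominus> g) = e \<oplus> h"
    proof -
      have "x \<otimes> (y \<ominus> g) = (x \<otimes> y) \<ominus> g \<otimes> x" using x y gc by (simp add: a_minus_def r_distr r_minus m_comm)
      also have "\<dots> = e \<oplus> h" unfolding e(3) z2 using ec gc x by (simp add: a_minus_def a_assoc r_neg)
      finally show ?thesis .
    qed
    also have "\<dots> \<in> p" using e hp by auto
    finally have "y \<ominus> g \<in> p" using p.I_prime[of x "y \<ominus> g"] x y gc by auto
    moreover have "y = (y \<ominus> g) \<oplus> g" using y gc by (simp add: a_minus_def a_assoc l_neg)
    ultimately show "y \<in> p <+>\<^bsub>S\<^esub> ord_ideal (n - c)" using go unfolding mem_add_ideals_iff by blast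
  qed
qed

text \<open>The ring \<open>S\<close> is local. An element with nonzero constant term has leading
  monomial \<open>{#}\<close>, so every monomial in the variables is a leading monomial of
  \<open>I\<close>, and dividing \<open>\<one>\<close> by \<open>I\<close> leaves remainder
  zero.\<close>

lemma proper_ideal_subset:
  assumes I: "ideal I S" "I \<noteq> carrier S"
  shows "I \<subseteq> ord_ideal 1"
proof
  interpret I: ideal I S by fact
  fix f assume f: "f \<in> I"
  then have fc: "f \<in> carrier S" by (rule I.Icarr)
  have "f {#} = \<zero>\<^bsub>K\<^esub>"
  proof (rule ccontr)
    assume n: "f {#} \<noteq> \<zero>\<^bsub>K\<^esub>"
    have "\<not> mless N {#}" for N by (auto simp: mless_def)
    then have "{#} \<in> lms I" using n f by (auto simp: lms_def is_lm_def)
    then have all: "M \<in> lms I" if "set_mset M \<subseteq> {1..d}" for M using lms_add[OF I(1) _ that, of "{#}"] by simp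
    obtain B :: "nat multiset set" and F where B: "finite B" "F \<in> B \<rightarrow> I"
      and div: "\<forall>n. \<forall>z\<in>ord_ideal n. \<exists>q w. (\<forall>A\<in>B. q A \<in> ord_ideal (n - size A)) \<and> w \<in> carrier S \<and>
         (\<forall>M\<in>lms I. w M = \<zero>\<^bsub>K\<^esub>) \<and> z = (\<Oplus>A\<in>B. q A \<otimes> F A) \<oplus> w"
      by (rule division[OF I(1)]) (rule that)
    obtain q w where q: "\<And>A. A \<in> B \<Longrightarrow> q A \<in> ord_ideal (0 - size A)" and w: "w \<in> carrier S"
       "\<And>M. M \<in> lms I \<Longrightarrow> w M = \<zero>\<^bsub>K\<^esub>" "\<one> = (\<Oplus>A\<in>B. q A \<otimes> F A) \<oplus> w"
      using div[rule_format, of \<one> 0] by (auto simp: ord_ideal_0)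
    have "w = \<zero>" unfolding eq_zero_iff using all w coeff_vars by blast
    moreover have "(\<Oplus>A\<in>B. q A \<otimes> F A) \<in> I"
      using B q by (intro I.finsum_mem) (auto intro!: I.I_l_closed simp: ord_ideal_0)
    ultimately have "\<one> \<in> I" using w I.Icarr by simp
    then show False using I I.one_imp_carrier by blast
  qed
  then show "f \<in> ord_ideal 1" using fc by (auto simp: ord_ideal_def)
qed

lemma scalars_carrier: "scalars \<subseteq> carrier S"
  by (auto simp: scalars_def)

text \<open>The monomials of degree below \<open>s\<close> span. Their number enters the final count
  only as a constant factor.\<close>

lemma span_mod_ord_ideal:
  obtains gs where "set gs \<subseteq> carrier S" "span_mod scalars (ord_ideal s) gs = carrier S"
proof -
  have "finite {M :: nat multiset. set_mset M \<subseteq> {1..d} \<and> size M < s}"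
    by (rule finite_bounded_multisets[OF finite_atLeastAtMost])
  then obtain Es where Es: "set Es = {M :: nat multiset. set_mset M \<subseteq> {1..d} \<and> size M < s}"
    using finite_list by metis
  have mc: "set (map (cterm \<one>\<^bsub>K\<^esub>) Fs) \<subseteq> carrier S" if "\<And>E. E \<in> set Fs \<Longrightarrow> set_mset E \<subseteq> {1..d}" for Fs
    using that by auto
  have *: "\<exists>Ks. length Ks = length Fs \<and> set Ks \<subseteq> scalars \<and>
      (\<forall>E\<in>set Fs. (z \<ominus> combine Ks (map (cterm \<one>\<^bsub>K\<^esub>) Fs)) E = \<zero>\<^bsub>K\<^esub>)"
    if "\<And>E. E \<in> set Fs \<Longrightarrow> set_mset E \<subseteq> {1..d}" "z \<in> carrier S" for Fs z
    using that
  proof (induction Fs)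
    case (Cons E Fs)
    then obtain Ks where Ks: "length Ks = length Fs" "set Ks \<subseteq> scalars"
      "\<forall>E\<in>set Fs. (z \<ominus> combine Ks (map (cterm \<one>\<^bsub>K\<^esub>) Fs)) E = \<zero>\<^bsub>K\<^esub>" by auto
    let ?c = "combine Ks (map (cterm \<one>\<^bsub>K\<^esub>) Fs)"
    have cc: "?c \<in> carrier S" using Ks scalars_carrier mc[of Fs] Cons.prems by (intro combine_in_carrier) auto
    \<comment> \<open>The defect still present at \<open>E\<close>; correcting it by
      \<open>cterm a E\<close> changes no other coefficient. If \<open>E\<close> occurs again in
      \<open>Fs\<close>, the defect is already zero.\<close>
    define a where "a = (z \<ominus> ?c) E"
    have ac: "a \<in> carrier K" unfolding a_def using coeff_closed[OF minus_closed[OF Cons.prems(2) cc]] .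
    have tc: "cterm a {#} \<otimes> cterm \<one>\<^bsub>K\<^esub> E = cterm a E"
      using ac Cons.prems(1)[of E] by (intro ext) (auto simp: coeff_cterm_mult, auto simp: cterm_def)
    have van: "(z \<ominus> (cterm a E \<oplus> ?c)) D = \<zero>\<^bsub>K\<^esub>" if "D \<in> set (E # Fs)" for D
    proof -
      have "cterm a E \<in> carrier S" using ac Cons.prems by simp
      then have e: "(z \<ominus> (cterm a E \<oplus> ?c)) D = (z \<ominus> ?c) D \<ominus>\<^bsub>K\<^esub> cterm a E D"
        using cc Cons.prems(2) by (simp add: a_minus_def K.minus_add K.a_ac)
      show ?thesis
      proof (cases "D = E")
        case True
        then show ?thesis using e ac by (simp only: a_def[symmetric]) (simp add: cterm_def K.r_neg a_minus_def)
      next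
        case False
        then have "(z \<ominus> ?c) D = \<zero>\<^bsub>K\<^esub>" using that Ks by auto
        then show ?thesis unfolding e using False by (simp add: cterm_def a_minus_def)
      qed
    qed
    have "combine (cterm a {#} # Ks) (map (cterm \<one>\<^bsub>K\<^esub>) (E # Fs)) = cterm a E \<oplus> ?c"
      by (simp only: combine.simps list.map tc)
    moreover have "length (cterm a {#} # Ks) = length (E # Fs)" "set (cterm a {#} # Ks) \<subseteq> scalars"
      using Ks ac by (auto simp: scalars_def)
    ultimately show ?case using van by metis
  qed auto
  have "z \<in> span_mod scalars (ord_ideal s) (map (cterm \<one>\<^bsub>K\<^esub>) Es)" if z: "z \<in> carrier S" for z
  proof -
    obtain Ks where Ks: "length Ks = length Es" "set Ks \<subseteq> scalars"
      "\<forall>E\<in>set Es. (z \<ominus> combine Ks (map (cterm \<one>\<^bsub>K\<^esub>) Es)) E = \<zero>\<^bsub>K\<^esub>" using *[of Es z] Es z by auto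
    have "combine Ks (map (cterm \<one>\<^bsub>K\<^esub>) Es) \<in> carrier S"
      using Ks scalars_carrier mc[of Es] Es by (intro combine_in_carrier) auto
    then have zc: "z \<ominus> combine Ks (map (cterm \<one>\<^bsub>K\<^esub>) Es) \<in> carrier S" using z by simp
    then have "z \<ominus> combine Ks (map (cterm \<one>\<^bsub>K\<^esub>) Es) \<in> ord_ideal s"
      using Ks(3) Es coeff_vars[OF zc] by (auto simp: ord_ideal_def)
    then show ?thesis using Ks z by (auto simp: span_mod_def)
  qed
  then show ?thesis using that[of "map (cterm \<one>\<^bsub>K\<^esub>) Es"] mc[of Es] Es by (auto simp: span_mod_def)
qed

text \<open>Induction along the chain: the tail starting at \<open>p 1\<close> gives
  \<open>N ^ r\<close> elements independent modulo \<open>p 1\<close> and high order, and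
  multiplying them by the powers below \<open>N\<close> of some \<open>x\<close> in
  \<open>p 1\<close> but not in \<open>p 0\<close> gives \<open>N\<close> times as many modulo
  \<open>p 0\<close>. By Artin--Rees each factor \<open>x\<close> costs a bounded order
  \<open>c\<close>, so the order needed stays linear in \<open>N\<close>. For \<open>r = 0\<close>
  the single element \<open>\<one>\<close> suffices.\<close>

lemma prime_chain_indep:
  assumes "\<And>i. i \<le> r \<Longrightarrow> primeideal (p i) S" "\<And>i. i < r \<Longrightarrow> p i \<subset> p (Suc i)"
  shows "\<exists>C. \<forall>N. \<exists>ys. length ys = N ^ r \<and> set ys \<subseteq> carrier S \<and>
    indep_mod scalars (p 0 <+>\<^bsub>S\<^esub> ord_ideal (1 + C * N)) ys"
  using assms
proof (induction r arbitrary: p)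
  case 0
  interpret p: primeideal "p 0" S using 0 by blast
  have sub: "p 0 <+>\<^bsub>S\<^esub> ord_ideal 1 \<subseteq> ord_ideal 1"
    using proper_ideal_subset[OF p.is_ideal] p.I_notcarr by (intro add_ideals_least ord_ideal_ideal) auto
  have "indep_mod scalars (p 0 <+>\<^bsub>S\<^esub> ord_ideal 1) [\<one>]"
    unfolding indep_mod_def
  proof (intro allI impI, elim conjE)
    fix Ks assume Ks: "length Ks = length [\<one>]" "set Ks \<subseteq> scalars" "combine Ks [\<one>] \<in> p 0 <+>\<^bsub>S\<^esub> ord_ideal 1"
    then obtain l where l: "Ks = [l]" "l \<in> scalars" by (cases Ks) auto
    then obtain a where a: "l = cterm a {#}" "a \<in> carrier K" by (auto simp: scalars_def)
    have "l \<in> ord_ideal 1" using Ks(3) sub l a by auto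
    then have "l {#} = \<zero>\<^bsub>K\<^esub>" unfolding ord_ideal_def by simp
    then have "l = \<zero>" unfolding a eq_zero_iff by (simp add: cterm_def)
    then show "set Ks \<subseteq> {\<zero>}" using l by simp
  qed
  then show ?case by (intro exI[of _ 0] allI exI[of _ "[\<one>]"]) auto
next
  case (Suc r)
  obtain C where C: "\<And>N. \<exists>ys. length ys = N ^ r \<and> set ys \<subseteq> carrier S \<and>
    indep_mod scalars (p 1 <+>\<^bsub>S\<^esub> ord_ideal (1 + C * N)) ys"
    using Suc.IH[of "\<lambda>i. p (Suc i)"] Suc.prems by auto
  have p01: "p 0 \<subset> p 1" using Suc.prems(2)[of 0] by simp
  then obtain x where x: "x \<in> p 1" "x \<notin> p 0" by blast
  interpret p0: primeideal "p 0" S using Suc.prems by blast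
  interpret p1: primeideal "p 1" S using Suc.prems(1)[of 1] by simp
  have xc: "x \<in> carrier S" using x p1.Icarr by blast
  obtain c where c: "\<And>n y. y \<in> carrier S \<Longrightarrow> x \<otimes> y \<in> p 0 <+>\<^bsub>S\<^esub> ord_ideal n \<Longrightarrow> y \<in> p 0 <+>\<^bsub>S\<^esub> ord_ideal (n - c)"
    using artin_rees[OF p0.primeideal xc x(2)] by blast
  have "\<exists>ys. length ys = N ^ Suc r \<and> set ys \<subseteq> carrier S \<and>
    indep_mod scalars (p 0 <+>\<^bsub>S\<^esub> ord_ideal (1 + (C + c) * N)) ys" for N
  proof -
    obtain ys where ys: "length ys = N ^ r" "set ys \<subseteq> carrier S"
      "indep_mod scalars (p 1 <+>\<^bsub>S\<^esub> ord_ideal (1 + C * N)) ys" using C by blast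
    \<comment> \<open>Each further factor \<open>x\<close> is paid for by \<open>c\<close> more
      orders, so that cancelling \<open>x\<close> leads from \<open>W (Suc n)\<close> to
      \<open>W n\<close>.\<close>
    define W where "W n = p 0 <+>\<^bsub>S\<^esub> ord_ideal (1 + C * N + c * n)" for n
    have "indep_mod scalars (W N) (power_multiples x ys N)"
    proof (rule indep_mod_power_multiples[OF scalars_subfield ys(2) xc ys(3)])
      fix n y z assume h: "y \<in> carrier S" "z \<in> carrier S" "y \<oplus> x \<otimes> z \<in> W (Suc n)"
      then obtain a b where ab: "a \<in> p 0" "b \<in> ord_ideal (1 + C * N + c * Suc n)" "y \<oplus> x \<otimes> z = a \<oplus> b"
        unfolding W_def mem_add_ideals_iff by blast
      have bo: "b \<in> ord_ideal (1 + C * N)" "b \<in> carrier S"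
        using ab ord_ideal_antimono[of "1 + C * N" "1 + C * N + c * Suc n"] by (auto simp: ord_ideal_def)
      have ac: "a \<in> carrier S" using ab by auto
      have "y = (y \<oplus> x \<otimes> z) \<ominus> x \<otimes> z" using h xc by (simp add: a_minus_def a_assoc r_neg)
      also have "\<dots> = (a \<ominus> x \<otimes> z) \<oplus> b" unfolding ab(3) using ac bo h xc by (simp add: a_minus_def a_ac)
      finally have "y = (a \<ominus> x \<otimes> z) \<oplus> b" .
      \<comment> \<open>Both \<open>p 0\<close> and \<open>x\<close> lie in \<open>p 1\<close>, so
        modulo \<open>p 1\<close> only the high-order part \<open>b\<close> remains.\<close>
      moreover have "a \<ominus> x \<otimes> z \<in> p 1" using ab p01 x h by (intro p1.minus_mem p1.I_r_closed) auto
      ultimately show "y \<in> p 1 <+>\<^bsub>S\<^esub> ord_ideal (1 + C * N)" using bo unfolding mem_add_ideals_iff by blast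
    next
      fix n z assume h: "z \<in> carrier S" "x \<otimes> z \<in> W (Suc n)"
      then show "z \<in> W n" using c[of z "1 + C * N + c * Suc n"] by (simp add: W_def)
    qed
    moreover have "W N = p 0 <+>\<^bsub>S\<^esub> ord_ideal (1 + (C + c) * N)" by (simp add: W_def algebra_simps)
    ultimately show ?thesis using ys power_multiples_closed[OF xc ys(2)]
      by (intro exI[of _ "power_multiples x ys N"]) auto
  qed
  then show ?case by blast
qed

text \<open>The two counts are compared modulo order \<open>1 + C * N\<close>: the independent
  elements number \<open>N ^ Suc (length fs)\<close>, the spanning ones grow only like
  \<open>N ^ length fs\<close>. Hypothesis \<open>s\<close> says that \<open>fs\<close> generates a
  power of the maximal ideal up to arbitrarily high order, which avoids any closedness of
  ideals.\<close>

theorem no_long_prime_chain: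
  assumes p: "\<And>i. i \<le> Suc (length fs) \<Longrightarrow> primeideal (p i) S"
      "\<And>i. i < Suc (length fs) \<Longrightarrow> p i \<subset> p (Suc i)"
    and fs: "set fs \<subseteq> ord_ideal 1"
    and s: "\<And>n. ord_ideal s \<subseteq> Idl (set fs) <+>\<^bsub>S\<^esub> ord_ideal n"
  shows False
proof -
  let ?e = "length fs"
  have fsc: "set fs \<subseteq> carrier S" using fs by (auto simp: ord_ideal_def)
  obtain C where C: "\<And>N. \<exists>ys. length ys = N ^ Suc ?e \<and> set ys \<subseteq> carrier S \<and>
    indep_mod scalars (p 0 <+>\<^bsub>S\<^esub> ord_ideal (1 + C * N)) ys"
    using prime_chain_indep[of "Suc ?e" p] p by blast
  obtain gs where gs: "set gs \<subseteq> carrier S" "span_mod scalars (ord_ideal s) gs = carrier S"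
    using span_mod_ord_ideal .
  have le: "N ^ Suc ?e \<le> (1 + C * N) ^ ?e * length gs" for N
  proof -
    let ?n = "1 + C * N"
    obtain ys where ys: "length ys = N ^ Suc ?e" "set ys \<subseteq> carrier S"
      "indep_mod scalars (p 0 <+>\<^bsub>S\<^esub> ord_ideal ?n) ys" using C by blast
    have "span_mod scalars (gen_mod (ord_ideal ?n) fs) gs = carrier S"
      using gs(2) s[of ?n] gen_mod_superset[OF ord_ideal_ideal fsc] by (fastforce simp: span_mod_def)
    moreover have "f [^] ?n \<in> ord_ideal ?n" if "f \<in> set fs" for f
      using that fs by (intro ord_ideal_pow) auto
    ultimately obtain hs where hs: "length hs = ?n ^ ?e * length gs" "set hs \<subseteq> carrier S"
      "span_mod scalars (ord_ideal ?n) hs = carrier S"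
      using span_mod_gen_mod[OF scalars_carrier ord_ideal_ideal fsc _ gs(1)] by blast
    have p0: "ideal (p 0) S" using p(1)[of 0] primeideal.axioms(1) by blast
    have U: "ideal (p 0 <+>\<^bsub>S\<^esub> ord_ideal ?n) S" using p0 ord_ideal_ideal by (rule add_ideals)
    have "ord_ideal ?n \<subseteq> p 0 <+>\<^bsub>S\<^esub> ord_ideal ?n"
      using p0 by (rule add_ideals_right) (auto simp: ord_ideal_def)
    then have "carrier S \<subseteq> span_mod scalars (p 0 <+>\<^bsub>S\<^esub> ord_ideal ?n) hs"
      using hs(3) span_mod_mono by metis
    then have "set ys \<subseteq> span_mod scalars (p 0 <+>\<^bsub>S\<^esub> ord_ideal ?n) hs" using ys(2) by blast
    then have "\<not> length hs < length ys" using dependent_mod[OF scalars_subfield U hs(2)] ys(3) by blast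
    then show ?thesis using hs ys by simp
  qed
  \<comment> \<open>Just above the constant factor of the upper bound. The summand 1 also keeps
    \<open>N\<close> positive, which the next inequality requires.\<close>
  define N where "N = (1 + C) ^ ?e * length gs + 1"
  have "1 + C * N \<le> (1 + C) * N" by (simp add: N_def)
  then have "(1 + C * N) ^ ?e \<le> (1 + C) ^ ?e * N ^ ?e" by (metis power_mono power_mult_distrib zero_le)
  then have "(1 + C * N) ^ ?e * length gs \<le> (1 + C) ^ ?e * N ^ ?e * length gs" by (rule mult_le_mono1)
  also have "\<dots> < N ^ ?e * N" by (simp add: N_def algebra_simps)
  also have "\<dots> = N ^ Suc ?e" by simp
  finally show False using le[of N] by simp
qed

end

section \<open>Transfer along quotient maps\<close>

definition prime_chain :: "('a, 'm) ring_scheme \<Rightarrow> nat \<Rightarrow> (nat \<Rightarrow> 'a set) \<Rightarrow> bool"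
  where "prime_chain R n p \<longleftrightarrow> (\<forall>i\<le>n. primeideal (p i) R) \<and> (\<forall>i<n. p i \<subset> p (Suc i))"

lemma prime_chain_Cons:
  assumes "prime_chain R n p" "primeideal q R" "q \<subset> p 0"
  shows "prime_chain R (Suc n) (case_nat q p)"
  using assms by (auto simp: prime_chain_def split: nat.split)

lemma prime_chain_subset:
  assumes "prime_chain R n p" "i \<le> n" shows "p 0 \<subseteq> p i"
  using assms(2)
proof (induction i)
  case (Suc i)
  then show ?case using assms(1) by (auto simp: prime_chain_def Suc_le_eq)
qed simp

lemma krull_dim_eq: "krull_dim R = (SUP n \<in> {n. \<exists>p. prime_chain R n p}. enat n)"
  by (simp add: krull_dim_def prime_chain_def)

lemma prime_chain_le_krull_dim: "prime_chain R n p \<Longrightarrow> enat n \<le> krull_dim R"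
  unfolding krull_dim_eq by (intro SUP_upper) auto

text \<open>If no chain had length \<open>e\<close>, all lengths would be at most
  \<open>e - 1\<close>. The prime \<open>q\<close> supplies the chain of length 0 for the case
  \<open>e = 0\<close>; the zero ring has dimension 0 but no chain.\<close>

lemma krull_dim_attained:
  assumes "krull_dim R = enat e" "primeideal q R"
  shows "\<exists>p. prime_chain R e p"
proof (rule ccontr)
  assume n: "\<nexists>p. prime_chain R e p"
  have "prime_chain R 0 (\<lambda>_. q)" using assms(2) by (simp add: prime_chain_def)
  with n have e: "e > 0" by (cases e) auto
  have "krull_dim R \<le> enat (e - 1)"
    unfolding krull_dim_eq
  proof (rule SUP_least)
    fix m assume "m \<in> {n. \<exists>p. prime_chain R n p}"
    then obtain p where p: "prime_chain R m p" by blast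
    then have "m \<le> e" using prime_chain_le_krull_dim[OF p] assms(1) by simp
    moreover have "m \<noteq> e" using n p by blast
    ultimately show "enat m \<le> enat (e - 1)" by simp
  qed
  then show False using assms(1) e by simp
qed

lemma primeideal_subset: "primeideal p R \<Longrightarrow> p \<subseteq> carrier R"
  by (intro additive_subgroup.a_subset ideal.axioms(1) primeideal.axioms(1))

text \<open>The correspondence of ideals under a surjection, later applied to the quotient maps from
  \<open>S\<close> to \<open>R\<close> and from \<open>R\<close> to \<open>R Quot p\<close>.\<close>

locale surj_ring_hom = ring_hom_ring R T h + R: cring R + S: cring T
  for R (structure) and T (structure) and h +
  assumes surj: "h ` carrier R = carrier T"
begin

lemma exists_preimage: "t \<in> carrier T \<Longrightarrow> \<exists>r\<in>carrier R. t = h r"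
  unfolding surj[symmetric] by blast

lemma image_ideal: assumes "ideal J R" shows "ideal (h ` J) T"
proof -
  interpret J: ideal J R by fact
  show ?thesis
  proof (rule idealI[OF S.ring_axioms])
    show "subgroup (h ` J) (add_monoid T)"
    proof (rule S.add.subgroupI)
      show "h ` J \<subseteq> carrier T" using J.Icarr by auto
      show "h ` J \<noteq> {}" using J.zero_closed by blast
      fix a assume "a \<in> h ` J"
      then obtain x where x: "x \<in> J" "a = h x" by blast
      then have "\<ominus>\<^bsub>T\<^esub> a = h (\<ominus> x)" using J.Icarr by simp
      also have "\<dots> \<in> h ` J" using x(1) by (intro imageI J.a_inv_closed)
      finally show "\<ominus>\<^bsub>T\<^esub> a \<in> h ` J" .
      fix b assume "b \<in> h ` J"
      then obtain y where y: "y \<in> J" "b = h y" by blast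
      have "a \<oplus>\<^bsub>T\<^esub> b = h (x \<oplus> y)" using x y J.Icarr by simp
      also have "\<dots> \<in> h ` J" using x(1) y(1) by (intro imageI J.a_closed)
      finally show "a \<oplus>\<^bsub>T\<^esub> b \<in> h ` J" .
    qed
    fix a t assume "a \<in> h ` J" "t \<in> carrier T"
    then obtain x r where x: "x \<in> J" "a = h x" "r \<in> carrier R" "t = h r" using surj by blast
    have "t \<otimes>\<^bsub>T\<^esub> a = h (r \<otimes> x)" "a \<otimes>\<^bsub>T\<^esub> t = h (x \<otimes> r)" using x J.Icarr by simp_all
    moreover have "r \<otimes> x \<in> J" "x \<otimes> r \<in> J" using x J.I_l_closed J.I_r_closed by blast+
    ultimately show "t \<otimes>\<^bsub>T\<^esub> a \<in> h ` J" "a \<otimes>\<^bsub>T\<^esub> t \<in> h ` J" by (metis imageI)+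
  qed
qed

lemma hom_minus: "a \<in> carrier R \<Longrightarrow> b \<in> carrier R \<Longrightarrow> h (a \<ominus> b) = h a \<ominus>\<^bsub>T\<^esub> h b"
  by (simp add: R.minus_eq S.minus_eq)

lemma mem_image_ideal_iff:
  assumes "ideal J R" "a_kernel R T h \<subseteq> J" "x \<in> carrier R"
  shows "h x \<in> h ` J \<longleftrightarrow> x \<in> J"
proof
  interpret J: ideal J R by fact
  assume "h x \<in> h ` J"
  then obtain y where y: "y \<in> J" "h x = h y" by blast
  then have yc: "y \<in> carrier R" using J.Icarr by blast
  have "h (x \<ominus> y) = h x \<ominus>\<^bsub>T\<^esub> h y" by (rule hom_minus[OF assms(3) yc])
  also have "\<dots> = \<zero>\<^bsub>T\<^esub>" unfolding y(2) S.minus_eq by (rule S.r_neg[OF hom_closed[OF yc]])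
  finally have "h (x \<ominus> y) = \<zero>\<^bsub>T\<^esub>" .
  then have "x \<ominus> y \<in> a_kernel R T h"
    unfolding a_kernel_def' using R.minus_closed[OF assms(3) yc] by blast
  then have "x \<ominus> y \<in> J" using assms(2) by blast
  then show "x \<in> J" using y(1) assms(3) by (rule J.minus_add_mem)
qed blast

lemma image_primeideal:
  assumes "primeideal D R" "a_kernel R T h \<subseteq> D"
  shows "primeideal (h ` D) T"
proof (rule primeidealI)
  interpret D: primeideal D R by fact
  note iff = mem_image_ideal_iff[OF D.is_ideal assms(2)]
  show "ideal (h ` D) T" by (rule image_ideal[OF D.is_ideal])
  show "cring T" by (rule S.is_cring)
  show "carrier T \<noteq> h ` D"
  proof
    assume "carrier T = h ` D"
    then have "h \<one> \<in> h ` D" by (metis R.one_closed hom_closed)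
    then have "\<one> \<in> D" using iff by blast
    then show False using D.one_imp_carrier D.I_notcarr by blast
  qed
  fix a b assume ab: "a \<in> carrier T" "b \<in> carrier T" "a \<otimes>\<^bsub>T\<^esub> b \<in> h ` D"
  then obtain x y where x: "x \<in> carrier R" "a = h x" "y \<in> carrier R" "b = h y" using surj by blast
  have "h (x \<otimes> y) \<in> h ` D" using ab x by simp
  then have "x \<otimes> y \<in> D" using iff x by blast
  then show "a \<in> h ` D \<or> b \<in> h ` D" using D.I_prime x by blast
qed

lemma vimage_strict:
  assumes "M \<subset> M'" "M' \<subseteq> carrier T"
  shows "{r \<in> carrier R. h r \<in> M} \<subset> {r \<in> carrier R. h r \<in> M'}"
proof -
  obtain t where t: "t \<in> M'" "t \<notin> M" using assms(1) by blast
  then obtain r where "r \<in> carrier R" "t = h r" using assms(2) surj by blast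
  then show ?thesis using t assms(1) by blast
qed

lemma prime_chain_vimage:
  assumes "prime_chain T n c"
  shows "prime_chain R n (\<lambda>i. {r \<in> carrier R. h r \<in> c i})"
  unfolding prime_chain_def
proof (intro conjI allI impI)
  fix i assume "i \<le> n"
  then have "primeideal (c i) T" using assms by (simp add: prime_chain_def)
  then show "primeideal {r \<in> carrier R. h r \<in> c i} R" by (rule primeideal_vimage[OF R.is_cring])
next
  fix i assume i: "i < n"
  then have ci: "c i \<subset> c (Suc i)" "primeideal (c (Suc i)) T" using assms by (simp_all add: prime_chain_def)
  show "{r \<in> carrier R. h r \<in> c i} \<subset> {r \<in> carrier R. h r \<in> c (Suc i)}"
    by (rule vimage_strict[OF ci(1) primeideal_subset[OF ci(2)]])
qed

text \<open>Since chains increase, it is enough that the kernel lies in the first member; it then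
  lies in all of them and strictness survives.\<close>

lemma prime_chain_image:
  assumes c: "prime_chain R n c" and k: "a_kernel R T h \<subseteq> c 0"
  shows "prime_chain T n (\<lambda>i. h ` c i)"
proof -
  have ki: "a_kernel R T h \<subseteq> c i" if "i \<le> n" for i using prime_chain_subset[OF c that] k by blast
  show ?thesis
    unfolding prime_chain_def
  proof (intro conjI allI impI)
    fix i assume "i \<le> n"
    then have "primeideal (c i) R" using c by (simp add: prime_chain_def)
    then show "primeideal (h ` c i) T" using ki[OF \<open>i \<le> n\<close>] by (rule image_primeideal)
  next
    fix i assume i: "i < n"
    then have ci: "primeideal (c i) R" "primeideal (c (Suc i)) R" "c i \<subset> c (Suc i)"
      using c by (simp_all add: prime_chain_def)
    then obtain x where x: "x \<in> c (Suc i)" "x \<notin> c i" by blast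
    have xc: "x \<in> carrier R" using ideal.Icarr[OF primeideal.axioms(1)[OF ci(2)] x(1)] .
    have "h x \<notin> h ` c i"
      using mem_image_ideal_iff[OF primeideal.axioms(1)[OF ci(1)] ki[OF less_imp_le[OF i]] xc] x(2) by blast
    then show "h ` c i \<subset> h ` c (Suc i)" using x(1) ci(3) by blast
  qed
qed

end

lemma (in ideal) surj_ring_hom_rcos:
  assumes "cring R" shows "surj_ring_hom R (R Quot I) ((+>) I)"
  by (intro surj_ring_hom.intro surj_ring_hom_axioms.intro rcos_ring_hom_ring assms quotient_is_cring)
    (auto simp: FactRing_def A_RCOSETS_def')

lemma (in ideal) a_kernel_rcos: "a_kernel R (R Quot I) ((+>) I) = I"
proof -
  have "x \<in> I \<longleftrightarrow> x \<in> carrier R \<and> I +> x = I" for x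
    using rcos_const_imp_mem a_rcos_zero[OF is_ideal] Icarr by blast
  then show ?thesis by (auto simp: a_kernel_def' FactRing_def)
qed

section \<open>Finite length and descending chains of ideals\<close>

lemma (in cring) quot_module_submodule:
  assumes I: "ideal I R" and J: "ideal J (R Quot I)"
  shows "submodule J R (quot_module R I)"
proof -
  interpret J: ideal J "R Quot I" by fact
  have s: "subgroup J (add_monoid (R Quot I))" using J.additive_subgroup_axioms
    by (simp add: additive_subgroup_def)
  have "subgroup J (add_monoid (quot_module R I))"
    using s unfolding subgroup_def m_inv_def by (simp add: quot_module_def)
  moreover have "I +> r \<in> carrier (R Quot I)" if "r \<in> carrier R" for r
    using that by (auto simp: FactRing_def A_RCOSETS_def')
  ultimately show ?thesis
    by (intro submodule.intro submodule_axioms.intro) (auto simp: quot_module_def intro: J.I_l_closed)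
qed

text \<open>The images of the \<open>N i\<close> in the quotient by \<open>I\<close> are submodules,
  and an endless strict descent among them would make the length infinite. Pulling the stable value
  back to \<open>R\<close> adds \<open>I\<close>.\<close>

lemma (in cring) finite_length_stationary:
  fixes N :: "nat \<Rightarrow> 'a set"
  assumes I: "ideal I R" and len: "module_length R (quot_module R I) \<noteq> \<infinity>"
    and N: "\<And>i. ideal (N i) R" "\<And>i j. i \<le> j \<Longrightarrow> N j \<subseteq> N i"
  shows "\<exists>s. \<forall>n. N s \<subseteq> I <+>\<^bsub>R\<^esub> N n"
proof -
  interpret I: ideal I R by fact
  interpret h: surj_ring_hom R "R Quot I" "(+>) I" using is_cring by (rule I.surj_ring_hom_rcos)
  define M where "M i = (+>) I ` N i" for i
  have Mdec: "M j \<subseteq> M i" if "i \<le> j" for i j using N(2)[OF that] by (auto simp: M_def)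
  have Msub: "submodule (M i) R (quot_module R I)" for i
    unfolding M_def by (intro quot_module_submodule[OF I] h.image_ideal N)
  have "\<exists>s. \<forall>n\<ge>s. M n = M s"
  proof (rule ccontr)
    assume "\<nexists>s. \<forall>n\<ge>s. M n = M s"
    then have "\<forall>s. \<exists>n. n \<ge> s \<and> M n \<subset> M s" using Mdec by (metis psubsetI)
    then obtain nx where nx: "\<And>s. M (nx s) \<subset> M s" by metis
    define g where "g i = (nx ^^ i) 0" for i
    have g: "M (g (Suc i)) \<subset> M (g i)" for i using nx by (simp add: g_def)
    \<comment> \<open>Chains in \<open>module_length\<close> ascend, so the first
      \<open>n + 1\<close> members of the descending sequence are read backwards, with index
      \<open>n - i\<close>.\<close>
    have unbounded: "enat n \<le> module_length R (quot_module R I)" for n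
      unfolding module_length_def
    proof (rule SUP_upper, simp, intro exI conjI allI impI)
      fix i assume "i < n"
      then have "n - i = Suc (n - Suc i)" by simp
      then show "M (g (n - i)) \<subset> M (g (n - Suc i))" using g by simp
    qed (rule Msub)
    show False
    proof (cases "module_length R (quot_module R I)")
      case (enat m)
      then show False using unbounded[of "Suc m"] by simp
    qed (use len in simp)
  qed
  then obtain s where s: "\<And>n. n \<ge> s \<Longrightarrow> M n = M s" by blast
  have "N s \<subseteq> I <+>\<^bsub>R\<^esub> N n" for n
  proof
    fix f assume f: "f \<in> N s"
    have fc: "f \<in> carrier R" by (rule ideal.Icarr[OF N(1) f])
    have "M s \<subseteq> M n" using s[of n] Mdec[of n s] by (cases "n \<ge> s") auto
    then obtain g where g: "g \<in> N n" "I +> f = I +> g" using f by (auto simp: M_def)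
    have gc: "g \<in> carrier R" by (rule ideal.Icarr[OF N(1) g(1)])
    have "f \<ominus> g \<in> I" using g quotient_eq_iff_same_a_r_cos[OF I fc gc] by simp
    moreover have "f = (f \<ominus> g) \<oplus> g" using fc gc by (simp add: a_minus_def a_assoc l_neg)
    ultimately show "f \<in> I <+>\<^bsub>R\<^esub> N n" using g unfolding mem_add_ideals_iff by blast
  qed
  then show ?thesis by blast
qed

lemma (in ideal) ideal_prod_least:
  assumes "\<And>a b. a \<in> A \<Longrightarrow> b \<in> B \<Longrightarrow> a \<otimes> b \<in> I"
  shows "ideal_prod R A B \<subseteq> I"
proof
  fix x assume "x \<in> ideal_prod R A B"
  then show "x \<in> I" by induction (use assms in auto)
qed

section \<open>Quotients of the power series ring, and the contradiction from an annihilator inside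
  \<open>I\<close>\<close>

context power_series
begin

text \<open>The preimage of a proper ideal is proper, hence contained in \<open>ord_ideal 1\<close>.
  So the image of \<open>ord_ideal 1\<close> contains every proper ideal, which gives the uniqueness
  that the definite description requires.\<close>

lemma the_maximal_ideal_quot:
  assumes J: "ideal J S" "J \<noteq> carrier S"
  shows "the_maximal_ideal (S Quot J) = (+>\<^bsub>S\<^esub>) J ` ord_ideal 1"
    and "maximalideal ((+>\<^bsub>S\<^esub>) J ` ord_ideal 1) (S Quot J)"
proof -
  interpret J: ideal J S by fact
  interpret h: surj_ring_hom S "S Quot J" "(+>\<^bsub>S\<^esub>) J" using is_cring by (rule J.surj_ring_hom_rcos)
  let ?h = "(+>\<^bsub>S\<^esub>) J" and ?R = "S Quot J"
  have J1: "a_kernel S ?R ?h \<subseteq> ord_ideal 1" unfolding J.a_kernel_rcos using proper_ideal_subset[OF J] .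
  have sub: "M \<subseteq> ?h ` ord_ideal 1" if M: "ideal M ?R" "M \<noteq> carrier ?R" for M
  proof -
    interpret M: ideal M ?R by fact
    let ?P = "{f \<in> carrier S. ?h f \<in> M}"
    have "M \<subset> carrier ?R" using M M.Icarr by blast
    then have "?P \<noteq> carrier S" using h.vimage_strict[of M "carrier ?R"] by auto
    then have "?P \<subseteq> ord_ideal 1" by (rule proper_ideal_subset[OF h.ideal_vimage[OF M(1)]])
    moreover have "M \<subseteq> ?h ` ?P"
    proof
      fix t assume t: "t \<in> M"
      then obtain f where "f \<in> carrier S" "t = ?h f" using h.exists_preimage[OF M.Icarr[OF t]] by blast
      then show "t \<in> ?h ` ?P" using t by blast
    qed
    ultimately show ?thesis by blast
  qed
  have i1: "ideal (?h ` ord_ideal 1) ?R" by (rule h.image_ideal[OF ord_ideal_ideal])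
  have n1: "?h ` ord_ideal 1 \<noteq> carrier ?R"
  proof
    assume "?h ` ord_ideal 1 = carrier ?R"
    then have "?h \<one> \<in> ?h ` ord_ideal 1" using h.hom_closed[OF one_closed] by simp
    then have "\<one> \<in> ord_ideal 1" using h.mem_image_ideal_iff[OF ord_ideal_ideal J1 one_closed] by simp
    then show False by (auto simp: ord_ideal_def coeff_one)
  qed
  show m: "maximalideal (?h ` ord_ideal 1) ?R"
    using i1 n1 sub by (intro maximalidealI) blast+
  show "the_maximal_ideal ?R = ?h ` ord_ideal 1"
    unfolding the_maximal_ideal_def
  proof (rule the_equality[where P = "\<lambda>M. maximalideal M ?R", OF m])
    fix M assume "maximalideal M ?R"
    then interpret M: maximalideal M ?R .
    have "M \<subseteq> ?h ` ord_ideal 1" using sub[OF M.is_ideal] M.I_notcarr by blast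
    then show "M = ?h ` ord_ideal 1" 
      using M.I_maximal[OF i1 _ additive_subgroup.a_subset[OF ideal.axioms(1)[OF i1]]] n1 by blast
  qed
qed

text \<open>The core argument, for a prime \<open>p\<close> whose preimage in \<open>S\<close>
  contains \<open>P\<close>. When \<open>P\<close> is nonzero, the assumption \<open>sub\<close>
  makes the lifted parameters generate a power of the maximal ideal of \<open>S\<close> up to
  arbitrarily high order, although \<open>S\<close> has a chain of primes too long for their
  number.\<close>

lemma parameters_annihilator:
  assumes P: "primeideal P S" and Q: "primeideal Q S"
    and R: "R = S Quot (ideal_prod S P Q)"
    and p: "p \<in> Assh R" and Pp: "P \<subseteq> {f \<in> carrier S. ideal_prod S P Q +>\<^bsub>S\<^esub> f \<in> p}"
    and u: "u \<in> p" and xs: "system_of_parameters R xs"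
    and sub: "colon_zero R u \<subseteq> Idl\<^bsub>R\<^esub> (set xs)"
  shows False
proof -
  interpret P: primeideal P S by fact
  interpret Q: primeideal Q S by fact
  define J where "J = ideal_prod S P Q"
  define h where "h = (+>\<^bsub>S\<^esub>) J"
  have Ji: "ideal J S" unfolding J_def by (rule ideal_prod_is_ideal[OF P.is_ideal Q.is_ideal])
  have RJ: "R = S Quot J" unfolding R J_def ..
  have JPQ: "J \<subseteq> P" "J \<subseteq> Q" unfolding J_def using ideal_prod_inter[OF P.is_ideal Q.is_ideal] by auto
  have Jn: "J \<noteq> carrier S" using JPQ(1) P.I_notcarr P.a_subset by blast
  interpret J: ideal J S by fact
  interpret h: surj_ring_hom S R h unfolding h_def RJ using is_cring by (rule J.surj_ring_hom_rcos)
  have ker: "a_kernel S R h = J" unfolding h_def RJ by (rule J.a_kernel_rcos)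
  have pprime: "primeideal p R" and dimp: "krull_dim (R Quot p) = krull_dim R"
    using p by (auto simp: Assh_def Ass_def)
  interpret p: primeideal p R by fact
  define e where "e = length xs"
  have dim: "krull_dim R = enat e" and xsm: "set xs \<subseteq> the_maximal_ideal R"
    and len: "module_length R (quot_module R (Idl\<^bsub>R\<^esub> (set xs))) \<noteq> \<infinity>"
    using xs by (auto simp: system_of_parameters_def e_def)
  have mR: "the_maximal_ideal R = h ` ord_ideal 1" and mm: "maximalideal (h ` ord_ideal 1) R"
    using the_maximal_ideal_quot[OF Ji Jn] by (simp_all add: RJ h_def)
  interpret m: maximalideal "h ` ord_ideal 1" R by fact
  define I where "I = Idl\<^bsub>R\<^esub> (set xs)"
  have xsc: "set xs \<subseteq> carrier R" using xsm mR m.Icarr by auto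
  interpret I: ideal I R unfolding I_def by (rule h.S.genideal_ideal[OF xsc])
  have "I \<subseteq> h ` ord_ideal 1"
    unfolding I_def using xsm mR by (intro h.S.genideal_minimal m.is_ideal) simp
  then have I_proper: "I \<noteq> carrier R" using m.I_notcarr m.a_subset by blast
  have "\<forall>x\<in>set xs. \<exists>f. f \<in> ord_ideal 1 \<and> h f = x" using xsm mR by auto
  then obtain lift where lift: "\<And>x. x \<in> set xs \<Longrightarrow> lift x \<in> ord_ideal 1 \<and> h (lift x) = x" by metis
  define fs where "fs = map lift xs"
  have fs: "length fs = e" "set fs \<subseteq> ord_ideal 1" "h ` set fs = set xs"
    using lift by (force simp: fs_def e_def image_image)+
  have fsc: "set fs \<subseteq> carrier S" using fs(2) by (auto simp: ord_ideal_def)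
  interpret F: ideal "Idl\<^bsub>S\<^esub> (set fs)" S by (rule genideal_ideal[OF fsc])
  let ?F = "Idl\<^bsub>S\<^esub> (set fs)"
  have FJi: "ideal (?F <+>\<^bsub>S\<^esub> J) S" by (rule add_ideals[OF F.is_ideal Ji])
  have JF: "J \<subseteq> ?F <+>\<^bsub>S\<^esub> J" using J.a_subset by (rule add_ideals_right[OF F.is_ideal])
  \<comment> \<open>The preimage of \<open>I\<close> is generated by the lifted parameters together
    with the kernel \<open>J\<close>.\<close>
  have preI: "f \<in> ?F <+>\<^bsub>S\<^esub> J" if f: "f \<in> carrier S" "h f \<in> I" for f
  proof -
    have "set fs \<subseteq> ?F <+>\<^bsub>S\<^esub> J"
      using genideal_self[OF fsc] add_ideals_left[OF Ji F.a_subset] by blast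
    then have "set xs \<subseteq> h ` (?F <+>\<^bsub>S\<^esub> J)" unfolding fs(3)[symmetric] by blast
    then have "I \<subseteq> h ` (?F <+>\<^bsub>S\<^esub> J)"
      unfolding I_def by (rule h.S.genideal_minimal[OF h.image_ideal[OF FJi]])
    then have "h f \<in> h ` (?F <+>\<^bsub>S\<^esub> J)" using f by blast
    then show ?thesis using h.mem_image_ideal_iff[OF FJi _ f(1)] ker JF by simp
  qed

  define p' where "p' = {f \<in> carrier S. h f \<in> p}"
  have p'prime: "primeideal p' S" unfolding p'_def by (rule h.primeideal_vimage[OF is_cring pprime])
  have Pp': "P \<subseteq> p'" using Pp by (simp add: p'_def h_def J_def)
  interpret k: surj_ring_hom R "R Quot p" "(+>\<^bsub>R\<^esub>) p"
    using h.S.is_cring by (rule p.surj_ring_hom_rcos)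
  interpret D: "domain" "R Quot p" by (rule p.quotient_is_domain)
  \<comment> \<open>Membership in \<open>Assh\<close> gives \<open>R Quot p\<close> the full
    dimension \<open>e\<close>. The chain is pulled back to \<open>S\<close> in two steps as
    \<open>b\<close>, all of whose members contain \<open>p'\<close>.\<close>
  obtain c where c: "prime_chain (R Quot p) e c"
    using krull_dim_attained[OF _ D.zeroprimeideal] dimp dim by auto
  define b where "b = (\<lambda>i. {f \<in> carrier S. h f \<in> {r \<in> carrier R. p +>\<^bsub>R\<^esub> r \<in> c i}})"
  have b: "prime_chain S e b"
    unfolding b_def by (rule h.prime_chain_vimage[OF k.prime_chain_vimage[OF c]])
  have p'b: "p' \<subseteq> b 0"
  proof
    fix f assume f: "f \<in> p'"
    have "primeideal (c 0) (R Quot p)" using c by (simp add: prime_chain_def)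
    then have "\<zero>\<^bsub>R Quot p\<^esub> \<in> c 0"
      by (intro additive_subgroup.zero_closed ideal.axioms(1) primeideal.axioms(1))
    moreover have "p +>\<^bsub>R\<^esub> h f = \<zero>\<^bsub>R Quot p\<^esub>"
      unfolding FactRing_def using f by (simp add: h.S.a_rcos_zero[OF p.is_ideal] p'_def)
    ultimately show "f \<in> b 0" using f by (simp add: b_def p'_def)
  qed
  \<comment> \<open>Otherwise \<open>P\<close> could be put in front of \<open>b\<close>; as
    \<open>P\<close> contains \<open>J\<close>, this longer chain would pass to \<open>R\<close> and
    exceed its dimension.\<close>
  have "\<not> P \<subset> p'"
  proof
    assume "P \<subset> p'"
    then have ch: "prime_chain S (Suc e) (case_nat P b)" using p'b by (intro prime_chain_Cons b P.primeideal) blast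
    have "prime_chain R (Suc e) (\<lambda>i. h ` case_nat P b i)"
      by (rule h.prime_chain_image[OF ch]) (simp add: ker JPQ)
    from prime_chain_le_krull_dim[OF this] show False using dim by simp
  qed
  then have p'P: "p' = P" using Pp' by blast
  obtain v where vS: "v \<in> carrier S" "u = h v" using h.exists_preimage[OF p.Icarr[OF u]] by blast
  then have "v \<in> p'" using u by (simp add: p'_def)
  then have v: "v \<in> P" "u = h v" using vS p'P by simp_all
  show False
  proof (cases "P = {\<zero>}")
    case True
    then have "u = \<zero>\<^bsub>R\<^esub>" using v by simp
    then have "carrier R \<subseteq> colon_zero R u" by (auto simp: colon_zero_def)
    then show False using sub I_proper I.a_subset unfolding I_def by blast
  next
    case False
    \<comment> \<open>The chain \<open>b\<close> starts at or above the nonzero prime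
      \<open>P\<close>, so in the domain \<open>S\<close> the zero ideal extends it to length
      \<open>e + 1\<close>.\<close>
    then have "{\<zero>} \<subset> b 0" using p'b p'P P.zero_closed by blast
    then have ch: "prime_chain S (Suc e) (case_nat {\<zero>} b)"
      by (intro prime_chain_Cons b zeroprimeideal)
    \<comment> \<open>A lift \<open>v\<close> of \<open>u\<close> lies in \<open>P\<close>, so
      \<open>Q\<close> multiplies it into \<open>J\<close>: the image of \<open>Q\<close>
      annihilates \<open>u\<close> and hence lies in \<open>I\<close>.\<close>
    have QF: "Q \<subseteq> ?F <+>\<^bsub>S\<^esub> J"
    proof
      fix q assume q: "q \<in> Q"
      then have qc: "q \<in> carrier S" by (rule Q.Icarr)
      have vc: "v \<in> carrier S" using vS by simp
      have "v \<otimes>\<^bsub>S\<^esub> q \<in> J" unfolding J_def using v q by (intro ideal_prod.prod)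
      then have "q \<otimes>\<^bsub>S\<^esub> v \<in> a_kernel S R h" using qc vc by (simp add: m_comm ker)
      then have "h (q \<otimes>\<^bsub>S\<^esub> v) = \<zero>\<^bsub>R\<^esub>" unfolding a_kernel_def' by blast
      then have "h q \<otimes>\<^bsub>R\<^esub> u = \<zero>\<^bsub>R\<^esub>" unfolding v(2) using h.hom_mult[OF qc vc] by simp
      then have "h q \<in> colon_zero R u" unfolding colon_zero_def using h.hom_closed[OF qc] by blast
      then show "q \<in> ?F <+>\<^bsub>S\<^esub> J" using preI[OF qc] sub unfolding I_def by blast
    qed
    have Pm: "P \<subseteq> ord_ideal 1" using P.I_notcarr by (intro proper_ideal_subset P.is_ideal) simp
    \<comment> \<open>The factor \<open>P\<close> of \<open>J\<close> lies in the maximal ideal. So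
      if \<open>Q\<close> is contained in \<open>?F\<close> up to order \<open>n\<close>, then
      \<open>J\<close> is up to order \<open>Suc n\<close>, and \<open>QF\<close> carries this back
      to \<open>Q\<close>.\<close>
    have QFn: "Q \<subseteq> ?F <+>\<^bsub>S\<^esub> ord_ideal n" for n
    proof (induction n)
      case 0
      show ?case using Q.a_subset add_ideals_right[OF F.is_ideal, of "carrier S"] by (auto simp: ord_ideal_0)
    next
      case (Suc n)
      have Ui: "ideal (?F <+>\<^bsub>S\<^esub> ord_ideal (Suc n)) S" by (rule add_ideals[OF F.is_ideal ord_ideal_ideal])
      interpret U: ideal "?F <+>\<^bsub>S\<^esub> ord_ideal (Suc n)" S by fact
      have "J \<subseteq> ?F <+>\<^bsub>S\<^esub> ord_ideal (Suc n)"
        unfolding J_def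
      proof (rule U.ideal_prod_least)
        fix a q assume a: "a \<in> P" and q: "q \<in> Q"
        have "q \<in> ?F <+>\<^bsub>S\<^esub> ord_ideal n" using Suc.IH q by (rule subsetD)
        then obtain f g where fg: "f \<in> ?F" "g \<in> ord_ideal n" "q = f \<oplus>\<^bsub>S\<^esub> g"
          unfolding mem_add_ideals_iff by blast
        have gc: "g \<in> carrier S" using fg(2) by (simp add: ord_ideal_def)
        have "a \<otimes>\<^bsub>S\<^esub> q = a \<otimes>\<^bsub>S\<^esub> f \<oplus>\<^bsub>S\<^esub> a \<otimes>\<^bsub>S\<^esub> g"
          unfolding fg(3) by (rule r_distr[OF F.Icarr[OF fg(1)] gc P.Icarr[OF a]])
        moreover have "a \<otimes>\<^bsub>S\<^esub> g \<in> ord_ideal (Suc n)"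
          using ord_ideal_mult[OF subsetD[OF Pm a] fg(2)] by simp
        moreover have "a \<otimes>\<^bsub>S\<^esub> f \<in> ?F" by (rule F.I_l_closed[OF fg(1) P.Icarr[OF a]])
        ultimately show "a \<otimes>\<^bsub>S\<^esub> q \<in> ?F <+>\<^bsub>S\<^esub> ord_ideal (Suc n)" unfolding mem_add_ideals_iff by blast
      qed
      moreover have "?F \<subseteq> ?F <+>\<^bsub>S\<^esub> ord_ideal (Suc n)" using add_ideals_left[OF ord_ideal_ideal F.a_subset] .
      ultimately show ?case using QF add_ideals_least[OF Ui] by blast
    qed
    obtain s where s: "\<And>n. h ` ord_ideal s \<subseteq> I <+>\<^bsub>R\<^esub> (h ` ord_ideal n)"
      using h.S.finite_length_stationary[OF I.is_ideal, of "\<lambda>n. h ` ord_ideal n"]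
        len h.image_ideal[OF ord_ideal_ideal] ord_ideal_antimono unfolding I_def[symmetric]
      by (metis image_mono)
    have "ord_ideal s \<subseteq> ?F <+>\<^bsub>S\<^esub> ord_ideal n" for n
    proof
      fix f assume f: "f \<in> ord_ideal s"
      then have fc: "f \<in> carrier S" by (simp add: ord_ideal_def)
      have "h f \<in> I <+>\<^bsub>R\<^esub> (h ` ord_ideal n)" using s f by blast
      then obtain a g where a: "a \<in> I" "g \<in> ord_ideal n" "h f = a \<oplus>\<^bsub>R\<^esub> h g"
        unfolding h.S.mem_add_ideals_iff by blast
      have gc: "g \<in> carrier S" using a(2) by (simp add: ord_ideal_def)
      have "h (f \<ominus>\<^bsub>S\<^esub> g) = a"
        using a I.Icarr[OF a(1)] fc gc by (simp add: h.hom_minus h.S.minus_eq h.S.a_assoc h.S.r_neg)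
      then have fg: "f \<ominus>\<^bsub>S\<^esub> g \<in> ?F <+>\<^bsub>S\<^esub> J" using preI a fc gc by simp
      have Ui: "ideal (?F <+>\<^bsub>S\<^esub> ord_ideal n) S" by (rule add_ideals[OF F.is_ideal ord_ideal_ideal])
      interpret U: ideal "?F <+>\<^bsub>S\<^esub> ord_ideal n" S by fact
      have "?F \<subseteq> ?F <+>\<^bsub>S\<^esub> ord_ideal n" using add_ideals_left[OF ord_ideal_ideal F.a_subset] .
      \<comment> \<open>The kernel \<open>J\<close> is absorbed because it lies in \<open>Q\<close>,
        which \<open>QFn\<close> puts into the sum for every \<open>n\<close>.\<close>
      then have "f \<ominus>\<^bsub>S\<^esub> g \<in> ?F <+>\<^bsub>S\<^esub> ord_ideal n"
        using fg add_ideals_least[OF Ui] JPQ(2) QFn[of n] by blast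
      moreover have "g \<in> ?F <+>\<^bsub>S\<^esub> ord_ideal n"
        using add_ideals_right[OF F.is_ideal, of "ord_ideal n"] a(2) by (auto simp: ord_ideal_def)
      ultimately show "f \<in> ?F <+>\<^bsub>S\<^esub> ord_ideal n" using fc by (rule U.minus_add_mem)
    qed
    \<comment> \<open>With the zero ideal in front there are \<open>e + 2\<close> primes in the
      chain, against \<open>e\<close> lifted parameters.\<close>
    then show False
      using no_long_prime_chain[of fs "case_nat {\<zero>} b" s] ch fs by (simp add: prime_chain_def)
  qed
qed

end

theorem mainTheorem2:
  fixes K :: "('a, 'm) ring_scheme"
    and d :: nat
    and S :: "(nat multiset \<Rightarrow> 'a) ring"
    and R :: "(nat multiset \<Rightarrow> 'a) set ring"
    and P Q :: "(nat multiset \<Rightarrow> 'a) set"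
  assumes "field K"
    and "S = power_series_ring K d"
    and "primeideal P S" and "\<exists>L \<subseteq> linear_forms K d. P = Idl\<^bsub>S\<^esub> L"
    and "primeideal Q S" and "\<exists>L \<subseteq> linear_forms K d. Q = Idl\<^bsub>S\<^esub> L"
    and "R = S Quot (ideal_prod S P Q)"
  shows "\<forall>p\<in>Assh R. \<forall>u\<in>p. \<forall>I.
    (\<exists>xs. system_of_parameters R xs \<and> I = Idl\<^bsub>R\<^esub> (set xs)) \<longrightarrow> \<not> colon_zero R u \<subseteq> I"
proof (intro ballI allI impI notI)
  fix p u I
  assume p: "p \<in> Assh R" and u: "u \<in> p" and sub: "colon_zero R u \<subseteq> I"
    and "\<exists>xs. system_of_parameters R xs \<and> I = Idl\<^bsub>R\<^esub> (set xs)"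
  then obtain xs where xs: "system_of_parameters R xs" "I = Idl\<^bsub>R\<^esub> (set xs)" by blast
  interpret power_series K d S
    using assms(1,2) by (simp add: power_series_def power_series_axioms_def)
  interpret P: primeideal P S by fact
  interpret Q: primeideal Q S by fact
  let ?J = "ideal_prod S P Q"
  interpret J: ideal ?J S by (rule ideal_prod_is_ideal[OF P.is_ideal Q.is_ideal])
  interpret h: surj_ring_hom S R "(+>\<^bsub>S\<^esub>) ?J"
    unfolding assms(7) using is_cring by (rule J.surj_ring_hom_rcos)
  have pR: "primeideal p R" using p by (simp add: Assh_def Ass_def)
  then interpret p: primeideal p R .
  let ?p = "{f \<in> carrier S. ?J +>\<^bsub>S\<^esub> f \<in> p}"
  have pp: "primeideal ?p S" by (rule h.primeideal_vimage[OF is_cring pR])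
  have "?J \<subseteq> ?p"
  proof
    fix f assume f: "f \<in> ?J"
    have "?J +>\<^bsub>S\<^esub> f = \<zero>\<^bsub>R\<^esub>"
      unfolding assms(7) FactRing_def using a_rcos_zero[OF J.is_ideal f] by simp
    then show "f \<in> ?p" using J.Icarr[OF f] p.zero_closed by simp
  qed
  then consider "P \<subseteq> ?p" | "Q \<subseteq> ?p"
    using primeideal_divides_ideal_prod[OF pp P.is_ideal Q.is_ideal] by blast
  then show False
  proof cases
    case 1
    show False
      by (rule parameters_annihilator[OF assms(3,5,7) p 1 u xs(1)]) (use sub xs(2) in simp)
  next
    case 2
    \<comment> \<open>The product ideal is symmetric, so the case of \<open>Q\<close> is the
      previous one with the factors exchanged.\<close>
    have c: "?J = ideal_prod S Q P" by (rule ideal_prod_commute[OF P.is_ideal Q.is_ideal])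
    show False
      by (rule parameters_annihilator[OF assms(5,3) assms(7)[unfolded c] p 2[unfolded c] u xs(1)])
        (use sub xs(2) in simp)
  qed
qed

end
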